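(* Let $G$ be a locally compact abelian group and let $\mu$ be a weakly almost periodic measure on $G$. Then the hull $\mathbb{X}(\mu)$ is minimal if and only if $\mu$ is a strongly almost periodic measure.
   Context: $C_c(G)$ is the space of continuous compactly supported functions on $G$, and $C_u(G)$ the Banach space of bounded uniformly continuous complex functions on $G$ with the sup norm. A measure on $G$ is a (complex) Radon measure, i.e. a linear functional on $C_c(G)$ continuous in the inductive limit topology; the vague topology is the weak-* topology of this duality. A measure $\mu$ is translation bounded if $\sup_{x\in G}|\mu|(x+K)<\infty$ for every compact $K\subset G$, where $|\mu|$ is the variation measure. For $c\in C_c(G)$, $(c*\mu)(x)=\int_G c(x-t)\,d\mu(t)$. Translations are $T^tf(x)=f(x-t)$ for functions and $T^t\mu=\delta_t*\mu$ for measures. A function $f\in C_u(G)$ is Bohr almost periodic (resp. weakly almost periodic) if $\{T^tf: t\in G\}$ is precompact in the norm topology (resp. the weak topology) of $C_u(G)$. A translation bounded measure $\mu$ is strongly (resp. weakly) almost periodic if $c*\mu$ is a Bohr (resp. weakly) almost periodic function for every $c\in C_c(G)$. The hull of $\mu$ is $\mathbb{X}(\mu)=\overline{\{T^t\mu:t\in G\}}$ (closure in the vague topology); it is vaguely compact and $G$ acts continuously on it by $T$. It is minimal if the orbit $\{T^t\nu:t\in G\}$ is dense in $\mathbb{X}(\mu)$ for every $\nu\in\mathbb{X}(\mu)$. *)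

theory Defs
  imports "HOL-Analysis.Analysis"
begin

section \<open>Function spaces on a topological group\<close>

abbreviation supp :: "('g::topological_space \<Rightarrow> 'b::zero) \<Rightarrow> 'g set" where
  "supp f \<equiv> closure {x. f x \<noteq> 0}"

definition C_c :: "('g::topological_space \<Rightarrow> 'b::{topological_space,zero}) set" where
  "C_c = {f. continuous_on UNIV f \<and> compact (supp f)}"

definition C_K :: "'g::topological_space set \<Rightarrow> ('g \<Rightarrow> complex) set" where
  "C_K K = {f \<in> C_c. supp f \<subseteq> K}"

text \<open>Uniform continuity refers to the uniformity of the topological group, spelled out here because
  the type class of topological groups does not carry a uniformity.\<close>

definition C_u :: "('g::topological_ab_group_add \<Rightarrow> complex) set" where
  "C_u = {f. bounded (range f) \<and>
     (\<forall>e>0. \<exists>U. open U \<and> 0 \<in> U \<and> (\<forall>x y. x - y \<in> U \<longrightarrow> dist (f x) (f y) < e))}"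

text \<open>Topology of the sup norm on a set of bounded functions.\<close>

definition sup_norm_topology :: "('g \<Rightarrow> complex) set \<Rightarrow> ('g \<Rightarrow> complex) topology" where
  "sup_norm_topology S = mtopology_of (submetric (funspace UNIV euclidean_metric) S)"

definition complex_linear_on :: "('g \<Rightarrow> complex) set \<Rightarrow> (('g \<Rightarrow> complex) \<Rightarrow> complex) \<Rightarrow> bool" where
  "complex_linear_on V \<phi> \<longleftrightarrow>
     (\<forall>f\<in>V. \<forall>g\<in>V. \<phi> (\<lambda>x. f x + g x) = \<phi> f + \<phi> g) \<and>
     (\<forall>a. \<forall>f\<in>V. \<phi> (\<lambda>x. a * f x) = a * \<phi> f)"

definition weak_topology_C_u :: "('g::topological_ab_group_add \<Rightarrow> complex) topology" where
  "weak_topology_C_u = topology_generated_by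
     {{f \<in> C_u. \<phi> f \<in> U} | \<phi> U.
        complex_linear_on C_u \<phi> \<and> continuous_map (sup_norm_topology C_u) euclidean \<phi> \<and> open U}"

definition translate_fun :: "'g::ab_group_add \<Rightarrow> ('g \<Rightarrow> 'b) \<Rightarrow> 'g \<Rightarrow> 'b" where
  "translate_fun t f = (\<lambda>x. f (x - t))"

text \<open>Precompact means having compact closure, both for the norm and for the weak topology.\<close>

definition precompact_in :: "'a topology \<Rightarrow> 'a set \<Rightarrow> bool" where
  "precompact_in X S \<longleftrightarrow> S \<subseteq> topspace X \<and> compactin X (X closure_of S)"

definition bohr_almost_periodic :: "('g::topological_ab_group_add \<Rightarrow> complex) \<Rightarrow> bool" where
  "bohr_almost_periodic f \<longleftrightarrow>
     f \<in> C_u \<and> precompact_in (sup_norm_topology C_u) (range (\<lambda>t. translate_fun t f))"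

definition weakly_almost_periodic_fun :: "('g::topological_ab_group_add \<Rightarrow> complex) \<Rightarrow> bool" where
  "weakly_almost_periodic_fun f \<longleftrightarrow>
     f \<in> C_u \<and> precompact_in weak_topology_C_u (range (\<lambda>t. translate_fun t f))"

section \<open>Radon measures\<close>

definition seminorm_on :: "('g \<Rightarrow> complex) set \<Rightarrow> (('g \<Rightarrow> complex) \<Rightarrow> real) \<Rightarrow> bool" where
  "seminorm_on V p \<longleftrightarrow>
     (\<forall>f\<in>V. \<forall>g\<in>V. p (\<lambda>x. f x + g x) \<le> p f + p g) \<and>
     (\<forall>a. \<forall>f\<in>V. p (\<lambda>x. a * f x) = cmod a * p f)"

text \<open>The inductive limit topology is the finest locally convex topology on \<^term>\<open>C_c\<close> for which
  all inclusions of the normed spaces \<^term>\<open>C_K K\<close> with \<^term>\<open>K\<close> compact are continuous; it is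
  generated by the seminorms whose restrictions to all these spaces are continuous.\<close>

definition inductive_limit_topology :: "('g::topological_space \<Rightarrow> complex) topology" where
  "inductive_limit_topology = topology_generated_by
     {{g \<in> C_c. p (\<lambda>x. g x - f x) < r} | p f r.
        seminorm_on C_c p \<and>
        (\<forall>K. compact K \<longrightarrow> continuous_map (sup_norm_topology (C_K K)) euclidean p) \<and>
        f \<in> C_c}"

text \<open>Functionals on \<^term>\<open>C_c\<close> are total functions in HOL; membership in \<^term>\<open>extensional C_c\<close>
  fixes their irrelevant values elsewhere, so that equal functionals are equal terms.\<close>

definition radon_measures :: "(('g::topological_space \<Rightarrow> complex) \<Rightarrow> complex) set" where
  "radon_measures = {\<mu> \<in> extensional C_c.
     complex_linear_on C_c \<mu> \<and> continuous_map inductive_limit_topology euclidean \<mu>}"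

definition vague_topology :: "(('g::topological_space \<Rightarrow> complex) \<Rightarrow> complex) topology" where
  "vague_topology = topology_generated_by {{\<mu> \<in> radon_measures. \<mu> f \<in> U} | f U. f \<in> C_c \<and> open U}"

text \<open>The variation measure of \<^term>\<open>\<mu>\<close>: first as a positive functional on nonnegative functions in
  \<^term>\<open>C_c\<close>, then on open sets, and finally as the induced outer measure on arbitrary sets.\<close>

definition variation_functional ::
    "(('g::topological_space \<Rightarrow> complex) \<Rightarrow> complex) \<Rightarrow> ('g \<Rightarrow> real) \<Rightarrow> ennreal" where
  "variation_functional \<mu> f = (SUP g \<in> {g \<in> C_c. \<forall>x. cmod (g x) \<le> f x}. ennreal (cmod (\<mu> g)))"

definition variation_open :: "(('g::topological_space \<Rightarrow> complex) \<Rightarrow> complex) \<Rightarrow> 'g set \<Rightarrow> ennreal" where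
  "variation_open \<mu> U =
     (SUP f \<in> {f \<in> C_c. (\<forall>x. 0 \<le> f x \<and> f x \<le> 1) \<and> supp f \<subseteq> U}. variation_functional \<mu> f)"

definition variation :: "(('g::topological_space \<Rightarrow> complex) \<Rightarrow> complex) \<Rightarrow> 'g set \<Rightarrow> ennreal" where
  "variation \<mu> A = (INF U \<in> {U. open U \<and> A \<subseteq> U}. variation_open \<mu> U)"

definition translation_bounded ::
    "(('g::topological_ab_group_add \<Rightarrow> complex) \<Rightarrow> complex) \<Rightarrow> bool" where
  "translation_bounded \<mu> \<longleftrightarrow>
     (\<forall>K. compact K \<longrightarrow> (SUP x. variation \<mu> ((\<lambda>k. x + k) ` K)) < \<infinity>)"

definition convolve ::
    "('g::ab_group_add \<Rightarrow> complex) \<Rightarrow> (('g \<Rightarrow> complex) \<Rightarrow> complex) \<Rightarrow> 'g \<Rightarrow> complex" where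
  "convolve c \<mu> = (\<lambda>x. \<mu> (\<lambda>t. c (x - t)))"

text \<open>\<open>\<delta>\<^sub>t * \<mu>\<close> integrates \<open>f\<close> to \<open>\<integral> f(t + x) d\<mu>(x)\<close>.\<close>

definition translate_measure ::
    "'g::topological_ab_group_add \<Rightarrow> (('g \<Rightarrow> complex) \<Rightarrow> complex) \<Rightarrow> ('g \<Rightarrow> complex) \<Rightarrow> complex" where
  "translate_measure t \<mu> = (\<lambda>f\<in>C_c. \<mu> (\<lambda>x. f (t + x)))"

definition strongly_almost_periodic ::
    "(('g::topological_ab_group_add \<Rightarrow> complex) \<Rightarrow> complex) \<Rightarrow> bool" where
  "strongly_almost_periodic \<mu> \<longleftrightarrow>
     \<mu> \<in> radon_measures \<and> translation_bounded \<mu> \<and> (\<forall>c\<in>C_c. bohr_almost_periodic (convolve c \<mu>))"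

definition weakly_almost_periodic ::
    "(('g::topological_ab_group_add \<Rightarrow> complex) \<Rightarrow> complex) \<Rightarrow> bool" where
  "weakly_almost_periodic \<mu> \<longleftrightarrow>
     \<mu> \<in> radon_measures \<and> translation_bounded \<mu> \<and> (\<forall>c\<in>C_c. weakly_almost_periodic_fun (convolve c \<mu>))"

section \<open>The hull\<close>

definition orbit ::
    "(('g::topological_ab_group_add \<Rightarrow> complex) \<Rightarrow> complex) \<Rightarrow> (('g \<Rightarrow> complex) \<Rightarrow> complex) set" where
  "orbit \<mu> = range (\<lambda>t. translate_measure t \<mu>)"

definition hull_of ::
    "(('g::topological_ab_group_add \<Rightarrow> complex) \<Rightarrow> complex) \<Rightarrow> (('g \<Rightarrow> complex) \<Rightarrow> complex) set" where
  "hull_of \<mu> = vague_topology closure_of (orbit \<mu>)"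

definition minimal_hull :: "(('g::topological_ab_group_add \<Rightarrow> complex) \<Rightarrow> complex) \<Rightarrow> bool" where
  "minimal_hull \<mu> \<longleftrightarrow>
     (\<forall>\<nu>\<in>hull_of \<mu>. subtopology vague_topology (hull_of \<mu>) closure_of (orbit \<nu>) = hull_of \<mu>)"

end

theory Submission
  imports Defs
begin

text \<open>
  If \<open>\<mu>\<close> is strongly almost periodic and \<open>\<nu>\<close> is a vague limit of translates of \<open>\<mu>\<close>, then total
  boundedness of the orbits of finitely many \<open>c * \<mu>\<close> turns pointwise approximation of \<open>c * \<nu>\<close> by
  translates of \<open>c * \<mu>\<close> into uniform approximation; uniform approximation can be translated back,
  so \<open>\<mu>\<close> is a vague limit of translates of \<open>\<nu>\<close>.

  Conversely let \<open>h = c * \<mu>\<close> be weakly almost periodic. For every \<open>e > 0\<close> the orbit of \<open>h\<close> has a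
  nonempty pointwise open subset of sup norm diameter at most \<open>e\<close>. Otherwise one constructs
  \<open>t\<^sub>m\<close>, \<open>x\<^sub>n\<close>, \<open>x'\<^sub>n\<close> such that \<open>h(x\<^sub>n - t\<^sub>m) - h(x'\<^sub>n - t\<^sub>m)\<close> is bounded away from zero for \<open>n < m\<close>
  but smaller than \<open>1/(n+1)\<close> for \<open>m \<le> n\<close>, and a cluster point of the functionals
  \<open>u \<mapsto> u(x\<^sub>n) - u(x'\<^sub>n)\<close> contradicts weak compactness. If the hull is minimal, then by its compactness finitely
  many translates of such an open set cover it, so the orbit of \<open>h\<close> is totally bounded in norm.
\<close>

section \<open>Fragmentation of bounded matrices\<close>

text \<open>Each \<open>x\<close> is labelled by its choice of net points, one for every index. Only
  finitely many labels occur, and one representative of each label suffices, so separate finite nets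
  combine into a simultaneous one.\<close>

lemma common_finite_net:
  fixes R :: "'i \<Rightarrow> 'a \<Rightarrow> 'b \<Rightarrow> bool"
  assumes "finite I" and nets: "\<And>i. i \<in> I \<Longrightarrow> \<exists>N. finite N \<and> (\<forall>x. \<exists>y\<in>N. R i x y)"
  obtains X where "finite X" "\<And>x. \<exists>x'\<in>X. \<forall>i\<in>I. \<exists>y. R i x y \<and> R i x' y"
proof -
  have "\<forall>i\<in>I. \<exists>N. finite N \<and> (\<forall>x. \<exists>y\<in>N. R i x y)"
    using nets by blast
  from bchoice[OF this] obtain N where
    N: "\<And>i. i \<in> I \<Longrightarrow> finite (N i)" "\<And>i x. i \<in> I \<Longrightarrow> \<exists>y\<in>N i. R i x y"
    by blast
  define q where "q = (\<lambda>i x. SOME y. y \<in> N i \<and> R i x y)"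
  have q: "q i x \<in> N i" "R i x (q i x)" if "i \<in> I" for i x
    using someI_ex[of "\<lambda>y. y \<in> N i \<and> R i x y"] N(2)[OF that, of x] unfolding q_def by blast+
  \<comment> \<open>Restricting to \<open>I\<close> places the labels in a finite product; values at
    other indices could make the range of labels infinite.\<close>
  define Q where "Q = (\<lambda>x. \<lambda>i\<in>I. q i x)"
  have "range Q \<subseteq> PiE I N"
    using q(1) by (auto simp: Q_def)
  moreover have "finite (PiE I N)"
    using \<open>finite I\<close> N(1) by (rule finite_PiE)
  ultimately have "finite (range Q)"
    by (rule finite_subset)
  show thesis
  proof
    show "finite (inv Q ` range Q)"
      using \<open>finite (range Q)\<close> by blast
    show "\<exists>x'\<in>inv Q ` range Q. \<forall>i\<in>I. \<exists>y. R i x y \<and> R i x' y" for x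
    proof
      have "Q (inv Q (Q x)) = Q x"
        by (simp add: f_inv_into_f)
      then have "q i (inv Q (Q x)) = q i x" if "i \<in> I" for i
        using that unfolding Q_def by (metis restrict_apply')
      then show "\<forall>i\<in>I. \<exists>y. R i x y \<and> R i (inv Q (Q x)) y"
        using q(2) by metis
    qed auto
  qed
qed

text \<open>Openness of a set of rows in the initial topology of the maps \<open>\<lambda>t. A t x\<close>.\<close>

definition row_open :: "('t \<Rightarrow> 'x \<Rightarrow> 'a::metric_space) \<Rightarrow> 't set \<Rightarrow> bool" where
  "row_open A V \<longleftrightarrow>
     (\<forall>t\<in>V. \<exists>F \<delta>. finite F \<and> \<delta> > 0 \<and> (\<forall>s. (\<forall>x\<in>F. dist (A s x) (A t x) < \<delta>) \<longrightarrow> s \<in> V))"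

lemma row_open_UNIV: "row_open A UNIV"
  by (auto simp: row_open_def intro!: exI[of _ "{}"] exI[of _ "1::real"])

lemma row_open_Int:
  assumes "row_open A V" "row_open A W"
  shows "row_open A (V \<inter> W)"
  unfolding row_open_def
proof
  fix t assume "t \<in> V \<inter> W"
  then have t: "t \<in> V" "t \<in> W" by simp_all
  obtain F \<delta> where F: "finite F" "\<delta> > 0" "\<forall>s. (\<forall>x\<in>F. dist (A s x) (A t x) < \<delta>) \<longrightarrow> s \<in> V"
    using assms(1) t(1) unfolding row_open_def by meson
  obtain F' \<delta>' where F': "finite F'" "\<delta>' > 0"
      "\<forall>s. (\<forall>x\<in>F'. dist (A s x) (A t x) < \<delta>') \<longrightarrow> s \<in> W"
    using assms(2) t(2) unfolding row_open_def by meson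
  from F F' show "\<exists>F \<delta>. finite F \<and> \<delta> > 0 \<and> (\<forall>s. (\<forall>x\<in>F. dist (A s x) (A t x) < \<delta>) \<longrightarrow> s \<in> V \<inter> W)"
    by (intro exI[of _ "F \<union> F'"] exI[of _ "min \<delta> \<delta>'"]) auto
qed

lemma row_open_dist_less:
  assumes "finite F"
  shows "row_open A {t. \<forall>x\<in>F. dist (A t x) (a x) < e}"
  unfolding row_open_def
proof
  fix t assume t: "t \<in> {t. \<forall>x\<in>F. dist (A t x) (a x) < e}"
  \<comment> \<open>The least slack over \<open>F\<close>; the extra element 1 keeps the minimum
    meaningful when \<open>F\<close> is empty.\<close>
  define \<delta> where "\<delta> = Min (insert 1 ((\<lambda>x. e - dist (A t x) (a x)) ` F))"
  have "\<delta> > 0"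
    using assms t by (auto simp: \<delta>_def)
  moreover have "dist (A s x) (a x) < e" if "x \<in> F" "dist (A s x) (A t x) < \<delta>" for s x
  proof -
    have "\<delta> \<le> e - dist (A t x) (a x)"
      using assms that(1) by (auto simp: \<delta>_def)
    then show ?thesis
      using that(2) dist_triangle[of "A s x" "a x" "A t x"] by simp
  qed
  ultimately show "\<exists>F' \<delta>. finite F' \<and> \<delta> > 0 \<and>
      (\<forall>s. (\<forall>x\<in>F'. dist (A s x) (A t x) < \<delta>) \<longrightarrow> s \<in> {t. \<forall>x\<in>F. dist (A t x) (a x) < e})"
    using assms by blast
qed

lemma row_open_dist_greater: "row_open A {t. dist (A t x) (A t y) > e}"
  unfolding row_open_def
proof
  fix t assume t: "t \<in> {t. dist (A t x) (A t y) > e}"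
  \<comment> \<open>Half of the slack, because the entries in both columns may move.\<close>
  define \<delta> where "\<delta> = (dist (A t x) (A t y) - e) / 2"
  have "\<delta> > 0"
    using t by (simp add: \<delta>_def)
  moreover have "dist (A s x) (A s y) > e"
    if "dist (A s x) (A t x) < \<delta>" "dist (A s y) (A t y) < \<delta>" for s
    using that dist_triangle[of "A t x" "A t y" "A s x"] dist_triangle[of "A s x" "A t y" "A s y"]
    by (simp add: \<delta>_def dist_commute)
  ultimately show "\<exists>F \<delta>. finite F \<and> \<delta> > 0 \<and>
      (\<forall>s. (\<forall>x\<in>F. dist (A s x) (A t x) < \<delta>) \<longrightarrow> s \<in> {t. dist (A t x) (A t y) > e})"
    by (intro exI[of _ "{x, y}"] exI[of _ \<delta>]) auto
qed

section \<open>Finite nets and the alternative between small open sets and double sequences\<close>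

lemma bounded_finite_net:
  fixes f :: "'x \<Rightarrow> 'a::heine_borel"
  assumes "bounded (range f)" "e > 0"
  obtains N where "finite N" "\<And>x. \<exists>y\<in>N. dist (f x) y < e"
proof -
  have "compact (closure (range f))"
    using assms(1) by simp
  then have "\<forall>e>0. \<exists>N. finite N \<and> closure (range f) \<subseteq> (\<Union>y\<in>N. ball y e)"
    by (simp add: compact_eq_totally_bounded)
  then obtain N where N: "finite N" "closure (range f) \<subseteq> (\<Union>y\<in>N. ball y e)"
    using assms(2) by blast
  have "\<exists>y\<in>N. dist (f x) y < e" for x
  proof -
    have "f x \<in> closure (range f)"
      using closure_subset[of "range f"] by auto
    then show ?thesis
      using N(2) unfolding mem_ball[symmetric] dist_commute[of "f x"] by blast
  qed
  then show thesis
    using that N(1) by blast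
qed

text \<open>Suppose that columns agreeing up to \<open>\<delta>\<close> on \<open>T\<close> always
  agree up to \<open>e\<close> on \<open>V\<close>. Finitely many columns \<open>X\<close> represent
  all columns on \<open>T\<close>, and rows of \<open>V\<close> close to each other on
  \<open>X\<close> then differ by at most \<open>3 * e\<close> in every column, which
  \<open>large\<close> forbids.\<close>

lemma rows_separate_columns:
  fixes A :: "'t \<Rightarrow> 'x \<Rightarrow> 'a::heine_borel"
  assumes bdd: "\<And>t. bounded (range (A t))" and "e > 0" "\<delta> > 0" "finite T"
    and V: "row_open A V" "V \<noteq> {}"
    and large: "\<And>V. row_open A V \<Longrightarrow> V \<noteq> {} \<Longrightarrow> \<exists>s\<in>V. \<exists>t\<in>V. \<exists>x. dist (A s x) (A t x) > 3 * e"
  shows "\<exists>x x'. (\<forall>t\<in>T. dist (A t x) (A t x') < \<delta>) \<and> (\<exists>y\<in>V. dist (A y x) (A y x') > e)"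
proof (rule ccontr)
  assume neg: "\<not> ?thesis"
  have "\<exists>N. finite N \<and> (\<forall>x. \<exists>z\<in>N. dist (A t x) z < \<delta> / 2)" for t
    by (rule bounded_finite_net[OF bdd[of t], of "\<delta> / 2"]) (use \<open>\<delta> > 0\<close> in auto)
  then obtain X where X: "finite X"
      "\<And>x. \<exists>x'\<in>X. \<forall>t\<in>T. \<exists>z. dist (A t x) z < \<delta> / 2 \<and> dist (A t x') z < \<delta> / 2"
    using common_finite_net[OF \<open>finite T\<close>, of "\<lambda>t x z. dist (A t x) z < \<delta> / 2"] by metis
  obtain y where "y \<in> V"
    using V by blast
  \<comment> \<open>The tolerance \<open>e / 2\<close> keeps any two rows of \<open>W\<close> within
    \<open>e\<close> of each other on the representatives; \<open>W\<close> is again open and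
    nonempty, so \<open>large\<close> applies to it.\<close>
  define W where "W = V \<inter> {t. \<forall>x\<in>X. dist (A t x) (A y x) < e / 2}"
  have "row_open A W"
    unfolding W_def using V X by (intro row_open_Int row_open_dist_less)
  moreover have "y \<in> W"
    using \<open>y \<in> V\<close> \<open>e > 0\<close> by (simp add: W_def)
  ultimately obtain s t x where st: "s \<in> W" "t \<in> W" "dist (A s x) (A t x) > 3 * e"
    using large by blast
  obtain x' where x': "x' \<in> X" "\<forall>t\<in>T. \<exists>z. dist (A t x) z < \<delta> / 2 \<and> dist (A t x') z < \<delta> / 2"
    using X by blast
  then have "\<forall>t\<in>T. dist (A t x) (A t x') < \<delta>"
    by (meson dist_triangle_half_l)
  then have "dist (A y x) (A y x') \<le> e" if "y \<in> V" for y
    using neg that by (meson not_less)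
  then have "dist (A s x) (A s x') \<le> e" "dist (A t x) (A t x') \<le> e"
    using st by (simp_all add: W_def)
  moreover have "dist (A s x') (A t x') < e"
    using st \<open>x' \<in> X\<close> dist_triangle_half_l[of "A s x'" "A y x'" e "A t x'"]
    by (simp add: W_def)
  ultimately have "dist (A s x) (A t x) \<le> 3 * e"
    using dist_triangle[of "A s x" "A t x" "A s x'"] dist_triangle[of "A s x'" "A t x" "A t x'"]
    by (simp add: dist_commute)
  then show False
    using st by simp
qed

text \<open>If no nonempty open set of rows has small diameter, rows and columns are chosen in turn.
  The set \<open>T\<close> collects the rows already used, on which a new pair of columns must
  nearly agree; the shrinking open set \<open>V\<close>, on which the pair must stay apart, supplies
  all later rows.\<close>

lemma fragmented_or_double_sequence:
  fixes A :: "'t \<Rightarrow> 'x \<Rightarrow> 'a::heine_borel"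
  assumes bdd: "\<And>t. bounded (range (A t))" and "e > 0"
  obtains
    V where "row_open A V" "V \<noteq> {}" "\<And>s t x. s \<in> V \<Longrightarrow> t \<in> V \<Longrightarrow> dist (A s x) (A t x) \<le> e"
  | t x x' \<delta> where "\<delta> > 0" "\<And>m n. n < m \<Longrightarrow> dist (A (t m) (x n)) (A (t m) (x' n)) > \<delta>"
      "\<And>m n::nat. m \<le> n \<Longrightarrow> dist (A (t m) (x n)) (A (t m) (x' n)) < inverse (real (Suc n))"
proof (cases "\<exists>V. row_open A V \<and> V \<noteq> {} \<and> (\<forall>s\<in>V. \<forall>t\<in>V. \<forall>x. dist (A s x) (A t x) \<le> e)")
  case True
  then show thesis using that(1) by metis
next
  case False
  \<comment> \<open>The factor 3 in \<open>rows_separate_columns\<close> costs a third of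
    \<open>e\<close>.\<close>
  define \<delta> where "\<delta> = e / 3"
  have "\<delta> > 0" using \<open>e > 0\<close> by (simp add: \<delta>_def)
  have large: "\<exists>s\<in>V. \<exists>t\<in>V. \<exists>x. dist (A s x) (A t x) > 3 * \<delta>" if "row_open A V" "V \<noteq> {}" for V
    using False that unfolding \<delta>_def by (force simp: not_le)
  define P where "P = (\<lambda>(n::nat) (V, T, t, x, x'). row_open A V \<and> V \<noteq> {} \<and> finite T \<and> t \<in> T \<and>
     (\<forall>s\<in>T. dist (A s x) (A s x') < inverse (real (Suc n))) \<and> (\<forall>s\<in>V. dist (A s x) (A s x') > \<delta>))"
  \<comment> \<open>The next row comes from the old \<open>V\<close>, so all earlier pairs of
    columns separate it, while \<open>P\<close> puts it into the new \<open>T\<close>.\<close>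
  define Q where "Q = (\<lambda>(n::nat) (V :: 't set, T :: 't set, t :: 't, x :: 'x, x' :: 'x)
     (V' :: 't set, T' :: 't set, t' :: 't, y :: 'x, y' :: 'x).
     V' \<subseteq> V \<and> T \<subseteq> T' \<and> t' \<in> V)"
  have step: "\<exists>V' T' t' y y'. P n (V', T', t', y, y') \<and> V' \<subseteq> V \<and> T \<subseteq> T' \<and> t' \<in> V"
    if VT: "row_open A V" "V \<noteq> {}" "finite T" for V T n
  proof -
    obtain t where "t \<in> V" using VT by blast
    obtain y y' where y: "\<forall>s\<in>insert t T. dist (A s y) (A s y') < inverse (real (Suc n))"
        "\<exists>s\<in>V. dist (A s y) (A s y') > \<delta>"
      using rows_separate_columns[of A \<delta> "inverse (real (Suc n))" "insert t T" V] bdd \<open>\<delta> > 0\<close> VT large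
      by (metis finite_insert inverse_positive_iff_positive of_nat_0_less_iff zero_less_Suc)
    have "row_open A (V \<inter> {s. dist (A s y) (A s y') > \<delta>})"
      using that by (intro row_open_Int row_open_dist_greater)
    then have "P n (V \<inter> {s. dist (A s y) (A s y') > \<delta>}, insert t T, t, y, y')"
      using y that by (auto simp: P_def)
    then show ?thesis
      using \<open>t \<in> V\<close> by blast
  qed
  have "\<exists>\<sigma>. \<forall>n. P n (\<sigma> n) \<and> Q n (\<sigma> n) (\<sigma> (Suc n))"
  proof (rule dependent_nat_choice)
    show "\<exists>\<sigma>. P 0 \<sigma>"
      using step[OF row_open_UNIV UNIV_not_empty finite.emptyI, of 0] by metis
    show "\<exists>\<tau>. P (Suc n) \<tau> \<and> Q n \<sigma> \<tau>" if "P n \<sigma>" for \<sigma> n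
    proof -
      obtain V T t x x' where "\<sigma> = (V, T, t, x, x')" by (cases \<sigma>) auto
      moreover have "row_open A V" "V \<noteq> {}" "finite T"
        using that calculation by (auto simp: P_def)
      ultimately show ?thesis
        using step[of V T "Suc n"] by (auto simp: Q_def)
    qed
  qed
  then obtain \<sigma> where \<sigma>: "\<And>n. P n (\<sigma> n)" "\<And>n. Q n (\<sigma> n) (\<sigma> (Suc n))"
    by blast
  define V where "V = (\<lambda>n. fst (\<sigma> n))"
  define T where "T = (\<lambda>n. fst (snd (\<sigma> n)))"
  define t where "t = (\<lambda>n. fst (snd (snd (\<sigma> n))))"
  define x where "x = (\<lambda>n. fst (snd (snd (snd (\<sigma> n)))))"
  define x' where "x' = (\<lambda>n. snd (snd (snd (snd (\<sigma> n)))))"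
  have P: "t n \<in> T n" "\<And>s. s \<in> T n \<Longrightarrow> dist (A s (x n)) (A s (x' n)) < inverse (real (Suc n))"
       "\<And>s. s \<in> V n \<Longrightarrow> dist (A s (x n)) (A s (x' n)) > \<delta>" for n
    using \<sigma>(1)[of n] by (auto simp: P_def T_def t_def x_def x'_def V_def split: prod.splits)
  have Q: "V (Suc n) \<subseteq> V n" "T n \<subseteq> T (Suc n)" "t (Suc n) \<in> V n" for n
    using \<sigma>(2)[of n] by (auto simp: Q_def T_def t_def x_def x'_def V_def split: prod.splits)
  \<comment> \<open>Row \<open>t m\<close> was drawn from the open set of stage
    \<open>m - 1\<close>, which gives separation for all \<open>n < m\<close>. It lies in
    \<open>T m\<close>, so near agreement starts already at \<open>n = m\<close>.\<close>
  have "t m \<in> V n" if "n < m" for m n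
  proof -
    obtain k where "m = Suc k" "n \<le> k"
      using \<open>n < m\<close> by (cases m) auto
    then show ?thesis
      using Q(3)[of k] lift_Suc_antimono_le[of V n k] Q(1) by auto
  qed
  moreover have "t m \<in> T n" if "m \<le> n" for m n
    using P(1)[of m] lift_Suc_mono_le[of T m n] Q(2) that by auto
  ultimately show thesis
    using P \<open>\<delta> > 0\<close> by (intro that(2)[of \<delta> t x x']) auto
qed

section \<open>Weak compactness and double sequences\<close>

text \<open>By compactness the nested closures of the tails have a common point. It is described by
  the closed sets that eventually contain the sequence, so that closed conditions pass to it
  directly.\<close>

lemma compactin_cluster_point:
  assumes "compactin X K" "\<And>n::nat. s n \<in> K"
  obtains a where "a \<in> K" "\<And>C. closedin X C \<Longrightarrow> eventually (\<lambda>n. s n \<in> C) sequentially \<Longrightarrow> a \<in> C"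
proof -
  define Y where "Y = subtopology X K"
  define C where "C = (\<lambda>n. Y closure_of (s ` {n..}))"
  have topY: "topspace Y = K"
    using compactin_subset_topspace[OF assms(1)] by (auto simp: Y_def)
  have sub: "s ` {n..} \<subseteq> C n" for n
    unfolding C_def using assms(2) topY by (intro closure_of_subset) auto
  have "(\<Inter>n. C n) \<noteq> {}"
  proof (rule compact_space_imp_nest)
    show "compact_space Y"
      using assms(1) by (simp add: Y_def compact_space_subtopology)
    show "closedin Y (C n)" for n
      by (simp add: C_def)
    show "C n \<noteq> {}" for n
      using sub[of n] by auto
    show "decseq C"
      unfolding decseq_def C_def by (auto intro!: closure_of_mono image_mono)
  qed
  then obtain a where a: "\<And>n. a \<in> C n" by blast
  show thesis
  proof
    show "a \<in> K"
      using a[of 0] closure_of_subset_topspace[of Y] topY by (auto simp: C_def)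
    show "a \<in> D" if D: "closedin X D" "eventually (\<lambda>n. s n \<in> D) sequentially" for D
    proof -
      obtain n where n: "\<And>m. n \<le> m \<Longrightarrow> s m \<in> D"
        using D(2) unfolding eventually_sequentially by auto
      have "closedin Y (K \<inter> D)"
        unfolding Y_def using D(1) by (rule closedin_subtopology_Int_closed)
      moreover have "s ` {n..} \<subseteq> K \<inter> D"
        using n assms(2) by auto
      ultimately have "C n \<subseteq> K \<inter> D"
        unfolding C_def by (rule closure_of_minimal[rotated])
      then show ?thesis
        using a[of n] by auto
    qed
  qed
qed

section \<open>Continuity for the sup norm and the weak topology\<close>

lemma mdist_funspace_le_iff:
  fixes f g :: "'g \<Rightarrow> complex"
  assumes "bounded (range f)" "bounded (range g)"
  shows "mdist (funspace UNIV euclidean_metric) f g \<le> a \<longleftrightarrow> (\<forall>x. dist (f x) (g x) \<le> a)"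
  using assms funspace_mdist_le[of f UNIV euclidean_metric g a] by (simp add: Met_TC.fspace_def)

text \<open>A Lipschitz bound suffices; the pointwise bounds \<open>M\<close> keep the metric of the
  function space out of the applications.\<close>

lemma continuous_map_sup_norm_topology:
  fixes \<phi> :: "('g \<Rightarrow> complex) \<Rightarrow> 'b::metric_space"
  assumes "\<And>f g M. \<lbrakk>f \<in> S; g \<in> S; \<And>x. dist (f x) (g x) \<le> M\<rbrakk> \<Longrightarrow> dist (\<phi> f) (\<phi> g) \<le> B * M"
  shows "continuous_map (sup_norm_topology S) euclidean \<phi>"
proof -
  have "Lipschitz_continuous_map (submetric (funspace UNIV euclidean_metric) S) euclidean_metric \<phi>"
    unfolding Lipschitz_continuous_map_def
  proof (intro conjI exI ballI)
    fix f g assume fg: "f \<in> mspace (submetric (funspace UNIV euclidean_metric) S)"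
      "g \<in> mspace (submetric (funspace UNIV euclidean_metric) S)"
    then have "f \<in> S" "g \<in> S" "bounded (range f)" "bounded (range g)"
      by (auto simp: Met_TC.fspace_def)
    moreover from this have "dist (f x) (g x) \<le> mdist (funspace UNIV euclidean_metric) f g" for x
      using mdist_funspace_le_iff by blast
    ultimately show "mdist euclidean_metric (\<phi> f) (\<phi> g)
        \<le> B * mdist (submetric (funspace UNIV euclidean_metric) S) f g"
      using assms by (simp del: mdist_funspace)
  qed simp
  then show ?thesis
    using Lipschitz_continuous_imp_continuous_map unfolding sup_norm_topology_def by fastforce
qed

lemma topspace_weak_topology_C_u: "topspace weak_topology_C_u = C_u"
proof -
  let ?B = "{{f \<in> C_u. \<phi> f \<in> U} |\<phi> U. complex_linear_on C_u \<phi> \<and>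
        continuous_map (sup_norm_topology C_u) euclidean \<phi> \<and> open U}
        :: ('a \<Rightarrow> complex) set set"
  \<comment> \<open>The zero functional exhibits all of \<open>C_u\<close> as one of the generating
    sets.\<close>
  have "\<exists>\<phi> U. (C_u :: ('a \<Rightarrow> complex) set) = {f \<in> C_u. \<phi> f \<in> U} \<and> complex_linear_on C_u \<phi> \<and>
        continuous_map (sup_norm_topology C_u) euclidean \<phi> \<and> open U"
    by (intro exI[of _ "\<lambda>_. 0"] exI[of _ UNIV]) (simp add: complex_linear_on_def)
  then have "C_u \<in> ?B"
    by (rule CollectI)
  then have "C_u \<subseteq> \<Union>?B"
    by (rule Union_upper)
  moreover have "\<Union>?B \<subseteq> C_u"
    by (rule Union_least) auto
  ultimately show ?thesis
    unfolding weak_topology_C_u_def topology_generated_by_topspace by (rule antisym[rotated])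
qed

lemma continuous_map_weak_topology_C_u:
  assumes "complex_linear_on C_u \<phi>" "continuous_map (sup_norm_topology C_u) euclidean \<phi>"
  shows "continuous_map weak_topology_C_u euclidean \<phi>"
  unfolding continuous_map_def topspace_weak_topology_C_u
proof (intro conjI allI impI)
  fix U :: "complex set" assume "openin euclidean U"
  then have "\<exists>\<phi>' U'. {f \<in> C_u. \<phi> f \<in> U} = {f \<in> C_u. \<phi>' f \<in> U'} \<and> complex_linear_on C_u \<phi>' \<and>
        continuous_map (sup_norm_topology C_u) euclidean \<phi>' \<and> open U'"
    using assms by (intro exI[of _ \<phi>] exI[of _ U]) simp
  then have "{f \<in> C_u. \<phi> f \<in> U} \<in> {{f \<in> C_u. \<phi> f \<in> U} |\<phi> U. complex_linear_on C_u \<phi> \<and>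
        continuous_map (sup_norm_topology C_u) euclidean \<phi> \<and> open U}"
    by (rule CollectI)
  then show "openin weak_topology_C_u {f \<in> C_u. \<phi> f \<in> U}"
    unfolding weak_topology_C_u_def by (rule topology_generated_by_Basis)
qed simp

lemma bounded_range_add:
  fixes f g :: "'x \<Rightarrow> complex"
  shows "bounded (range f) \<Longrightarrow> bounded (range g) \<Longrightarrow> bounded (range (\<lambda>x. f x + g x))"
  by (rule bounded_plus_comp)

lemma bounded_range_mult:
  fixes f :: "'x \<Rightarrow> complex"
  assumes "bounded (range f)"
  shows "bounded (range (\<lambda>x. a * f x))"
  using bounded_linear_image[OF assms bounded_linear_mult_right[of a]] by (simp add: image_image)

lemma continuous_map_complex_mult_left:
  fixes f :: "'x \<Rightarrow> complex"
  assumes "continuous_map X euclidean f"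
  shows "continuous_map X euclidean (\<lambda>x. a * f x)"
proof -
  have "continuous_map euclidean euclidean ((*) a)"
    unfolding continuous_map_iff_continuous2 by (intro continuous_intros)
  from continuous_map_compose[OF assms this] show ?thesis
    by (simp add: o_def)
qed

text \<open>A substitute for Hahn-Banach: the functionals needed are cluster points of differences of
  point evaluations, and Tychonoff's theorem supplies them.\<close>

lemma cluster_functional:
  fixes x x' :: "nat \<Rightarrow> 'x"
  obtains \<psi> :: "('x \<Rightarrow> complex) \<Rightarrow> complex" where
    "complex_linear_on {u. bounded (range u)} \<psi>"
    "\<And>u v M. \<lbrakk>bounded (range u); bounded (range v); \<And>y. dist (u y) (v y) \<le> M\<rbrakk> \<Longrightarrow>
       dist (\<psi> u) (\<psi> v) \<le> 2 * M"
    "\<And>u C. \<lbrakk>bounded (range u); closed C; eventually (\<lambda>n. u (x n) - u (x' n) \<in> C) sequentially\<rbrakk> \<Longrightarrow> \<psi> u \<in> C"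
proof -
  define I where "I = {u :: 'x \<Rightarrow> complex. bounded (range u)}"
  have "\<forall>u\<in>I. \<exists>b. \<forall>y. cmod (u y) \<le> b"
    by (auto simp: I_def bounded_iff)
  then obtain b where b: "\<And>u y. u \<in> I \<Longrightarrow> cmod (u y) \<le> b u" by metis
  define X where "X = product_topology (\<lambda>_. euclidean :: complex topology) I"
  define D where "D = (\<lambda>n. \<lambda>u\<in>I. u (x n) - u (x' n))"
  \<comment> \<open>By Tychonoff's theorem a product of closed discs is compact; the radius
    \<open>2 * b u\<close> accommodates the difference of two values of \<open>u\<close>.\<close>
  have "compactin X (PiE I (\<lambda>u. cball 0 (2 * b u)))"
    by (auto simp: X_def compactin_PiE)
  moreover have "D n \<in> PiE I (\<lambda>u. cball 0 (2 * b u))" for n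
  proof -
    have "cmod (u (x n) - u (x' n)) \<le> 2 * b u" if "u \<in> I" for u
      using norm_triangle_ineq4[of "u (x n)" "u (x' n)"] b[OF that, of "x n"] b[OF that, of "x' n"]
      by linarith
    then show ?thesis
      by (auto simp: D_def)
  qed
  ultimately obtain \<psi> where \<psi>: "\<psi> \<in> PiE I (\<lambda>u. cball 0 (2 * b u))"
      and clus: "\<And>C. closedin X C \<Longrightarrow> eventually (\<lambda>n. D n \<in> C) sequentially \<Longrightarrow> \<psi> \<in> C"
    by (rule compactin_cluster_point[where s = D]) blast
  have topX: "topspace X = PiE I (\<lambda>_. UNIV)"
    by (simp add: X_def)
  have DX: "D n \<in> topspace X" for n
    by (simp add: topX D_def)
  have coord: "continuous_map X euclidean (\<lambda>p. p u)" if "u \<in> I" for u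
    unfolding X_def using that by (rule continuous_map_product_coordinates)
  have addI: "(\<lambda>y. u y + v y) \<in> I" if "u \<in> I" "v \<in> I" for u v
    using that unfolding I_def by (simp add: bounded_range_add)
  have multI: "(\<lambda>y. a * u y) \<in> I" if "u \<in> I" for u a
    using that unfolding I_def by (simp add: bounded_range_mult)
  \<comment> \<open>Linearity consists of closed conditions, each on finitely many coordinates, that
    hold for every \<open>D n\<close>; hence the cluster point inherits it.\<close>
  have add: "\<psi> (\<lambda>y. u y + v y) = \<psi> u + \<psi> v" if uv: "u \<in> I" "v \<in> I" for u v
  proof -
    have "closedin X {p \<in> topspace X. p (\<lambda>y. u y + v y) = p u + p v}"
      using uv addI[OF uv] by (intro closedin_continuous_maps_eq[of euclidean] continuous_map_add coord) auto
    from clus[OF this] DX show ?thesis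
      using uv addI[OF uv] by (auto simp: D_def)
  qed
  have mult: "\<psi> (\<lambda>y. a * u y) = a * \<psi> u" if u: "u \<in> I" for u a
  proof -
    have "closedin X {p \<in> topspace X. p (\<lambda>y. a * u y) = a * p u}"
      using u multI[OF u]
      by (intro closedin_continuous_maps_eq[of euclidean] continuous_map_complex_mult_left coord) auto
    from clus[OF this] DX show ?thesis
      using u multI[OF u] by (auto simp: D_def algebra_simps)
  qed
  have cl: "\<psi> u \<in> C" if "u \<in> I" "closed C" "eventually (\<lambda>n. u (x n) - u (x' n) \<in> C) sequentially" for u C
  proof -
    have "closedin X {p \<in> topspace X. p u \<in> C}"
      using that by (intro closedin_continuous_map_preimage[OF coord]) auto
    from clus[OF this] DX show ?thesis
      using that by (auto simp: D_def)
  qed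
  show thesis
  proof
    show "complex_linear_on {u. bounded (range u)} \<psi>"
      using add mult by (auto simp: complex_linear_on_def I_def)
    show "\<psi> u \<in> C"
      if "bounded (range u)" "closed C" "eventually (\<lambda>n. u (x n) - u (x' n) \<in> C) sequentially" for u C
      using cl that by (simp add: I_def)
    show "dist (\<psi> u) (\<psi> v) \<le> 2 * M"
      if "bounded (range u)" "bounded (range v)" and M: "\<And>y. dist (u y) (v y) \<le> M" for u v M
    proof -
      have uv: "u \<in> I" "v \<in> I"
        using that by (auto simp: I_def)
      \<comment> \<open>Linearity reduces the Lipschitz bound to the single function
        \<open>u - v\<close>, any two values of which differ by at most
        \<open>2 * M\<close>.\<close>
      define w where "w = (\<lambda>y. u y + (-1) * v y)"
      have w: "w \<in> I"
        unfolding w_def using uv by (intro addI multI)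
      have "cmod (w y) \<le> M" for y
        using M[of y] by (simp add: w_def dist_norm)
      then have "cmod (w (x n) - w (x' n)) \<le> 2 * M" for n
        using norm_triangle_ineq4[of "w (x n)" "w (x' n)"] by (smt (verit))
      then have "\<psi> w \<in> cball 0 (2 * M)"
        using w by (intro cl) auto
      moreover have "\<psi> w = \<psi> u - \<psi> v"
        unfolding w_def using add[OF uv(1) multI[OF uv(2), of "-1"]] mult[OF uv(2), of "-1"] by simp
      ultimately show ?thesis
        by (simp add: dist_norm norm_minus_commute)
    qed
  qed
qed

lemma bounded_C_u: "f \<in> C_u \<Longrightarrow> bounded (range f)"
  by (simp add: C_u_def)

lemma complex_linear_on_subset:
  "complex_linear_on V \<phi> \<Longrightarrow> W \<subseteq> V \<Longrightarrow> complex_linear_on W \<phi>"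
  unfolding complex_linear_on_def by blast

text \<open>One half of Grothendieck's double limit criterion for weak compactness.\<close>

lemma weakly_almost_periodic_fun_no_double_sequence:
  assumes wap: "weakly_almost_periodic_fun f" and "\<delta> > 0"
    and far: "\<And>m n. n < m \<Longrightarrow> dist (f (x n - t m)) (f (x' n - t m)) > \<delta>"
    and near: "\<And>m n::nat. m \<le> n \<Longrightarrow> dist (f (x n - t m)) (f (x' n - t m)) < inverse (real (Suc n))"
  shows False
proof -
  define g where "g = (\<lambda>m. translate_fun (t m) f)"
  define K where "K = weak_topology_C_u closure_of (range (\<lambda>t. translate_fun t f))"
  have sub: "range (\<lambda>t. translate_fun t f) \<subseteq> C_u" and "compactin weak_topology_C_u K"
    using wap by (auto simp: weakly_almost_periodic_fun_def precompact_in_def K_def topspace_weak_topology_C_u)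
  moreover have "g m \<in> K" for m
    using closure_of_subset[of "range (\<lambda>t. translate_fun t f)" weak_topology_C_u] sub
    by (auto simp: K_def g_def topspace_weak_topology_C_u)
  \<comment> \<open>A weak cluster point \<open>h\<close> of the translates exists; evaluating it in
    two ways will give the contradiction.\<close>
  ultimately obtain h where "h \<in> K"
      and h: "\<And>C. closedin weak_topology_C_u C \<Longrightarrow> eventually (\<lambda>m. g m \<in> C) sequentially \<Longrightarrow> h \<in> C"
    using compactin_cluster_point[of weak_topology_C_u K g] by blast
  have "h \<in> C_u"
    using \<open>h \<in> K\<close> closure_of_subset_topspace[of weak_topology_C_u]
    by (auto simp: K_def topspace_weak_topology_C_u)
  have gC: "g m \<in> C_u" for m
    using sub by (auto simp: g_def)
  \<comment> \<open>For fixed \<open>n\<close> the inequality holds for all \<open>m > n\<close> and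
    involves one weakly continuous functional, so it passes to \<open>h\<close>.\<close>
  have h_far: "dist (h (x n)) (h (x' n)) \<ge> \<delta>" for n
  proof -
    define \<phi> where "\<phi> = (\<lambda>u :: 'a \<Rightarrow> complex. u (x n) - u (x' n))"
    have "complex_linear_on C_u \<phi>"
      by (simp add: complex_linear_on_def \<phi>_def algebra_simps)
    moreover have "continuous_map (sup_norm_topology C_u) euclidean \<phi>"
    proof (rule continuous_map_sup_norm_topology)
      fix u v :: "'a \<Rightarrow> complex" and M assume "\<And>y. dist (u y) (v y) \<le> M"
      from this[of "x n"] this[of "x' n"] show "dist (\<phi> u) (\<phi> v) \<le> 2 * M"
        using norm_triangle_ineq4[of "u (x n) - v (x n)" "u (x' n) - v (x' n)"]
        by (simp add: \<phi>_def dist_norm norm_minus_commute algebra_simps)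
    qed
    ultimately have "continuous_map weak_topology_C_u euclidean \<phi>"
      by (rule continuous_map_weak_topology_C_u)
    then have "closedin weak_topology_C_u {u \<in> topspace weak_topology_C_u. \<phi> u \<in> - ball 0 \<delta>}"
      by (rule closedin_continuous_map_preimage) (simp add: closed_Compl)
    moreover have "eventually (\<lambda>m. g m \<in> {u \<in> topspace weak_topology_C_u. \<phi> u \<in> - ball 0 \<delta>}) sequentially"
      using eventually_gt_at_top[of n]
    proof eventually_elim
      case (elim m)
      then show ?case
        using far[OF elim] gC[of m]
        by (simp add: topspace_weak_topology_C_u \<phi>_def g_def translate_fun_def dist_norm norm_minus_commute)
    qed
    ultimately have "h \<in> {u \<in> topspace weak_topology_C_u. \<phi> u \<in> - ball 0 \<delta>}"
      by (rule h)
    then show ?thesis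
      by (simp add: \<phi>_def dist_norm norm_minus_commute)
  qed
  \<comment> \<open>The limit in the column index is taken by a single functional, a cluster point
    of the differences of evaluations.\<close>
  obtain \<psi> :: "('a \<Rightarrow> complex) \<Rightarrow> complex" where
    lin: "complex_linear_on {u. bounded (range u)} \<psi>" and
    lip: "\<And>u v M. \<lbrakk>bounded (range u); bounded (range v); \<And>y. dist (u y) (v y) \<le> M\<rbrakk> \<Longrightarrow>
       dist (\<psi> u) (\<psi> v) \<le> 2 * M" and
    cl: "\<And>u C. \<lbrakk>bounded (range u); closed C; eventually (\<lambda>n. u (x n) - u (x' n) \<in> C) sequentially\<rbrakk> \<Longrightarrow> \<psi> u \<in> C"
    by (rule cluster_functional[of x x']) (rule that, assumption, blast+)
  have "\<psi> h \<in> - ball 0 \<delta>"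
    using h_far bounded_C_u[OF \<open>h \<in> C_u\<close>] by (intro cl) (auto simp: dist_norm norm_minus_commute closed_Compl not_less)
  \<comment> \<open>For fixed \<open>m\<close> the differences tend to 0 as \<open>n\<close> grows,
    so their cluster value is 0.\<close>
  have \<psi>g: "\<psi> (g m) = 0" for m
  proof -
    have "cmod (\<psi> (g m)) \<le> e" if e: "e > 0" for e
    proof -
      obtain k where k: "inverse (real (Suc k)) < e"
        using reals_Archimedean[OF e] by blast
      have "eventually (\<lambda>n. g m (x n) - g m (x' n) \<in> cball 0 e) sequentially"
        using eventually_ge_at_top[of "max m k"]
      proof eventually_elim
        case (elim n)
        have "inverse (real (Suc n)) \<le> inverse (real (Suc k))"
          using elim by (intro le_imp_inverse_le) auto
        moreover have "dist (f (x n - t m)) (f (x' n - t m)) < inverse (real (Suc n))"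
          using elim by (intro near) simp
        ultimately have "dist (f (x n - t m)) (f (x' n - t m)) \<le> e"
          using k by linarith
        then show ?case
          by (simp add: g_def translate_fun_def dist_norm norm_minus_commute)
      qed
      then have "\<psi> (g m) \<in> cball 0 e"
        using bounded_C_u[OF gC[of m]] by (intro cl) auto
      then show ?thesis by simp
    qed
    then show ?thesis
      using field_le_epsilon[of "cmod (\<psi> (g m))" 0] by simp
  qed
  \<comment> \<open>Being weakly continuous and zero on every \<open>g m\<close>,
    \<open>\<psi>\<close> must also vanish at \<open>h\<close>, although \<open>\<psi> h\<close> has
    modulus at least \<open>\<delta>\<close>.\<close>
  have "continuous_map (sup_norm_topology C_u) euclidean \<psi>"
    by (rule continuous_map_sup_norm_topology[where B = 2]) (rule lip[OF bounded_C_u bounded_C_u])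
  moreover have "complex_linear_on C_u \<psi>"
    using lin by (rule complex_linear_on_subset) (auto simp: bounded_C_u)
  ultimately have "continuous_map weak_topology_C_u euclidean \<psi>"
    by (intro continuous_map_weak_topology_C_u)
  then have "closedin weak_topology_C_u {u \<in> topspace weak_topology_C_u. \<psi> u \<in> {0}}"
    by (rule closedin_continuous_map_preimage) simp
  then have "h \<in> {u \<in> topspace weak_topology_C_u. \<psi> u \<in> {0}}"
    using gC \<psi>g by (intro h) (auto simp: topspace_weak_topology_C_u)
  with \<open>\<psi> h \<in> - ball 0 \<delta>\<close> \<open>\<delta> > 0\<close> show False
    by simp
qed

text \<open>Rows are indexed by translations and columns by points. Weak compactness excludes the
  double sequence, which leaves the open set of small diameter.\<close>

lemma weakly_almost_periodic_fun_fragmented: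
  assumes wap: "weakly_almost_periodic_fun f" and "e > 0"
  obtains V where "row_open (\<lambda>t x. f (x - t)) V" "V \<noteq> {}"
    "\<And>s t x. s \<in> V \<Longrightarrow> t \<in> V \<Longrightarrow> dist (f (x - s)) (f (x - t)) \<le> e"
proof -
  have "bounded (range f)"
    using wap by (simp add: weakly_almost_periodic_fun_def bounded_C_u)
  then have "bounded (range (\<lambda>x. f (x - t)))" for t
    by (rule bounded_subset) auto
  then show thesis
    using \<open>e > 0\<close>
  proof (rule fragmented_or_double_sequence)
    fix V assume "row_open (\<lambda>t x. f (x - t)) V" "V \<noteq> {}"
      "\<And>s t x. s \<in> V \<Longrightarrow> t \<in> V \<Longrightarrow> dist (f (x - s)) (f (x - t)) \<le> e"
    then show thesis by (rule that)
  next
    fix t x x' \<delta> assume "\<delta> > 0"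
      "\<And>m n. n < m \<Longrightarrow> dist (f (x n - t m)) (f (x' n - t m)) > \<delta>"
      "\<And>m n::nat. m \<le> n \<Longrightarrow> dist (f (x n - t m)) (f (x' n - t m)) < inverse (real (Suc n))"
    then show thesis
      using weakly_almost_periodic_fun_no_double_sequence[OF wap] by blast
  qed
qed

section \<open>Radon measures dominated on an orbit\<close>

lemma C_c_compose:
  fixes f :: "'g::topological_space \<Rightarrow> 'b::{topological_space,zero}" and \<phi> :: "'h::t2_space \<Rightarrow> 'g"
  assumes f: "f \<in> C_c" and cont: "continuous_on UNIV \<phi>" "continuous_on UNIV \<psi>" and inv: "\<And>x. \<psi> (\<phi> x) = x"
  shows "(\<lambda>x. f (\<phi> x)) \<in> C_c" "supp (\<lambda>x. f (\<phi> x)) \<subseteq> \<psi> ` supp f"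
proof -
  \<comment> \<open>The left inverse \<open>\<psi>\<close> carries the support of \<open>f\<close>
    to a compact set that contains the new support as a closed subset.\<close>
  have comp: "compact (\<psi> ` supp f)"
    using f cont(2) by (auto simp: C_c_def intro!: compact_continuous_image intro: continuous_on_subset)
  have "x \<in> \<psi> ` supp f" if "f (\<phi> x) \<noteq> 0" for x
  proof (rule image_eqI)
    show "x = \<psi> (\<phi> x)"
      by (simp add: inv)
    show "\<phi> x \<in> supp f"
      using that by (intro subsetD[OF closure_subset]) simp
  qed
  then have "{x. f (\<phi> x) \<noteq> 0} \<subseteq> \<psi> ` supp f"
    by auto
  then show sub: "supp (\<lambda>x. f (\<phi> x)) \<subseteq> \<psi> ` supp f"
    using compact_imp_closed[OF comp] by (rule closure_minimal)
  have "compact (\<psi> ` supp f \<inter> supp (\<lambda>x. f (\<phi> x)))"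
    using comp by (rule compact_Int_closed) simp
  then have "compact (supp (\<lambda>x. f (\<phi> x)))"
    using sub by (simp add: Int_absorb1)
  moreover have "continuous_on UNIV (\<lambda>x. f (\<phi> x))"
    using f cont(1) by (auto simp: C_c_def intro: continuous_on_compose2)
  ultimately show "(\<lambda>x. f (\<phi> x)) \<in> C_c"
    by (simp add: C_c_def)
qed

lemma C_c_supp_subset:
  fixes f :: "'g::t2_space \<Rightarrow> 'b::{topological_space,zero}"
  assumes "continuous_on UNIV f" "compact K" "{x. f x \<noteq> 0} \<subseteq> K"
  shows "f \<in> C_c"
proof -
  have "supp f \<subseteq> K"
    using assms(3) compact_imp_closed[OF assms(2)] by (rule closure_minimal)
  moreover have "compact (K \<inter> supp f)"
    using assms(2) by (rule compact_Int_closed) simp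
  ultimately show ?thesis
    using assms(1) by (simp add: C_c_def Int_absorb1)
qed

lemma C_c_add:
  fixes f g :: "'g::t2_space \<Rightarrow> complex"
  assumes "f \<in> C_c" "g \<in> C_c"
  shows "(\<lambda>x. f x + g x) \<in> C_c"
proof (rule C_c_supp_subset)
  show "continuous_on UNIV (\<lambda>x. f x + g x)"
    using assms by (auto simp: C_c_def intro: continuous_on_add)
  show "compact (supp f \<union> supp g)"
    using assms by (auto simp: C_c_def)
  show "{x. f x + g x \<noteq> 0} \<subseteq> supp f \<union> supp g"
    using closure_subset[of "{x. f x \<noteq> 0}"] closure_subset[of "{x. g x \<noteq> 0}"] by fastforce
qed

lemma C_c_mult:
  fixes f :: "'g::t2_space \<Rightarrow> complex"
  assumes "f \<in> C_c"
  shows "(\<lambda>x. a * f x) \<in> C_c"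
proof (rule C_c_supp_subset)
  show "continuous_on UNIV (\<lambda>x. a * f x)"
    using assms by (auto simp: C_c_def intro: continuous_on_mult_left)
  show "compact (supp f)"
    using assms by (auto simp: C_c_def)
  show "{x. a * f x \<noteq> 0} \<subseteq> supp f"
    using closure_subset[of "{x. f x \<noteq> 0}"] by auto
qed

lemma C_c_diff:
  fixes f g :: "'g::t2_space \<Rightarrow> complex"
  assumes "f \<in> C_c" "g \<in> C_c"
  shows "(\<lambda>x. f x - g x) \<in> C_c"
  using C_c_add[OF assms(1) C_c_mult[OF assms(2), of "-1"]] by simp

lemma C_c_bounded:
  fixes f :: "'g::topological_space \<Rightarrow> complex"
  assumes "f \<in> C_c"
  obtains M where "M > 0" "\<And>x. cmod (f x) \<le> M"
proof -
  have "compact (f ` supp f)"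
    using assms by (auto simp: C_c_def intro!: compact_continuous_image intro: continuous_on_subset)
  then obtain M where M: "M > 0" "\<And>z. z \<in> f ` supp f \<Longrightarrow> cmod z \<le> M"
    using compact_imp_bounded bounded_pos by metis
  have "cmod (f x) \<le> M" for x
  proof (cases "f x = 0")
    case False
    then have "x \<in> supp f"
      by (intro subsetD[OF closure_subset]) simp
    then show ?thesis
      using M(2) by blast
  qed (use M(1) in simp)
  then show thesis
    using that M(1) by blast
qed

lemma C_c_translate:
  fixes f :: "'g::{topological_ab_group_add,t2_space} \<Rightarrow> 'b::{topological_space,zero}"
  assumes "f \<in> C_c"
  shows "(\<lambda>x. f (t + x)) \<in> C_c" "supp (\<lambda>x. f (t + x)) \<subseteq> (\<lambda>k. - t + k) ` supp f"
proof -
  have cont: "continuous_on UNIV (\<lambda>x. t + x)" "continuous_on UNIV (\<lambda>k. - t + k)"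
    by (intro continuous_intros)+
  show "(\<lambda>x. f (t + x)) \<in> C_c" "supp (\<lambda>x. f (t + x)) \<subseteq> (\<lambda>k. - t + k) ` supp f"
    by (rule C_c_compose[OF assms cont]; simp)+
qed

lemma C_c_reflect:
  fixes f :: "'g::{topological_ab_group_add,t2_space} \<Rightarrow> 'b::{topological_space,zero}"
  assumes "f \<in> C_c"
  shows "(\<lambda>t. f (x - t)) \<in> C_c"
proof -
  have cont: "continuous_on UNIV (\<lambda>t. x - t)"
    by (intro continuous_intros)
  show ?thesis
    by (rule C_c_compose(1)[OF assms cont cont]) simp
qed

section \<open>Linear functionals and bounds by the variation measure\<close>

lemma complex_linear_onD:
  assumes "complex_linear_on V \<phi>"
  shows "f \<in> V \<Longrightarrow> g \<in> V \<Longrightarrow> \<phi> (\<lambda>x. f x + g x) = \<phi> f + \<phi> g"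
    and "f \<in> V \<Longrightarrow> \<phi> (\<lambda>x. a * f x) = a * \<phi> f"
  using assms by (simp_all add: complex_linear_on_def)

lemma zero_in_C_c: "(\<lambda>_. 0) \<in> C_c"
  by (simp add: C_c_def)

lemma complex_linear_on_C_c_zero:
  assumes "complex_linear_on C_c \<mu>"
  shows "\<mu> (\<lambda>_. 0) = 0"
  using complex_linear_onD(2)[OF assms zero_in_C_c, of 0] by simp

lemma complex_linear_on_C_c_diff:
  fixes f g :: "'g::t2_space \<Rightarrow> complex"
  assumes lin: "complex_linear_on C_c \<mu>" and fg: "f \<in> C_c" "g \<in> C_c"
  shows "\<mu> (\<lambda>x. f x - g x) = \<mu> f - \<mu> g"
proof -
  have "\<mu> (\<lambda>x. f x + (-1) * g x) = \<mu> f + \<mu> (\<lambda>x. (-1) * g x)"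
    by (rule complex_linear_onD(1)[OF lin fg(1) C_c_mult[OF fg(2)]])
  moreover have "\<mu> (\<lambda>x. (-1) * g x) = (-1) * \<mu> g"
    by (rule complex_linear_onD(2)[OF lin fg(2)])
  ultimately show ?thesis by simp
qed

text \<open>After division by \<open>M\<close>, the function \<open>h\<close> competes in the
  supremum for the variation functional of its modulus \<open>f\<close>, and \<open>f\<close>
  competes in \<open>variation_open\<close> for every open set containing \<open>K\<close>.\<close>

lemma cmod_le_variation:
  fixes g :: "'g::t2_space \<Rightarrow> complex"
  assumes lin: "complex_linear_on C_c \<mu>" and g: "g \<in> C_K K" and M: "M > 0" "\<And>x. cmod (g x) \<le> M"
  shows "ennreal (cmod (\<mu> g)) \<le> ennreal M * variation \<mu> K"
proof -
  have gc: "g \<in> C_c" and supp: "supp g \<subseteq> K"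
    using g by (auto simp: C_K_def)
  define h where "h = (\<lambda>x. complex_of_real (1 / M) * g x)"
  define f where "f = (\<lambda>x. cmod (h x))"
  have hc: "h \<in> C_c"
    unfolding h_def by (rule C_c_mult[OF gc])
  have "{x. f x \<noteq> 0} = {x. g x \<noteq> 0}"
    using M(1) by (auto simp: f_def h_def)
  then have suppf: "supp f = supp g" by simp
  have "continuous_on UNIV f"
    unfolding f_def using hc by (auto simp: C_c_def intro: continuous_on_norm)
  then have fc: "f \<in> C_c"
    using suppf gc by (simp add: C_c_def)
  have f01: "0 \<le> f x \<and> f x \<le> 1" for x
    using M by (auto simp: f_def h_def norm_mult norm_divide)
  have "ennreal (cmod (\<mu> h)) \<le> variation_open \<mu> U" if "open U" "K \<subseteq> U" for U
  proof -
    have "ennreal (cmod (\<mu> h)) \<le> variation_functional \<mu> f"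
      unfolding variation_functional_def by (rule SUP_upper) (use hc in \<open>simp add: f_def\<close>)
    also have "\<dots> \<le> variation_open \<mu> U"
      unfolding variation_open_def by (rule SUP_upper) (use fc f01 suppf supp that in auto)
    finally show ?thesis .
  qed
  then have "ennreal (cmod (\<mu> h)) \<le> variation \<mu> K"
    unfolding variation_def by (intro INF_greatest) auto
  moreover have "\<mu> h = complex_of_real (1 / M) * \<mu> g"
    unfolding h_def by (rule complex_linear_onD(2)[OF lin gc])
  then have "cmod (\<mu> g) = M * cmod (\<mu> h)"
    using M(1) by (simp add: norm_mult norm_divide)
  ultimately show ?thesis
    using M(1) by (simp add: ennreal_mult mult_left_mono)
qed

text \<open>The constant is the supremum of the variation over all translates of \<open>K\<close>;
  the shifted function is supported in one of them, so the bound does not depend on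
  \<open>t\<close>.\<close>

lemma translation_bounded_estimate:
  fixes \<mu> :: "('g::{topological_ab_group_add,t2_space} \<Rightarrow> complex) \<Rightarrow> complex"
  assumes lin: "complex_linear_on C_c \<mu>" and tb: "translation_bounded \<mu>" and K: "compact K"
  obtains B where "\<And>f t M. \<lbrakk>f \<in> C_K K; \<And>x. cmod (f x) \<le> M\<rbrakk> \<Longrightarrow> cmod (\<mu> (\<lambda>x. f (t + x))) \<le> B * M"
proof -
  define S where "S = (SUP x. variation \<mu> ((\<lambda>k. x + k) ` K))"
  have "S < \<infinity>"
    using tb K unfolding translation_bounded_def S_def by blast
  then obtain B where B: "B \<ge> 0" "S = ennreal B"
    by (cases S) auto
  show thesis
  proof
    fix f t M assume f: "f \<in> C_K K" and M: "\<And>x. cmod (f x) \<le> M"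
    have "0 \<le> M"
      using M[of 0] norm_ge_zero order_trans by blast
    have fc: "f \<in> C_c" "supp f \<subseteq> K"
      using f by (auto simp: C_K_def)
    \<comment> \<open>The case \<open>M = 0\<close> is separate because
      \<open>cmod_le_variation\<close> rescales by \<open>M\<close>.\<close>
    show "cmod (\<mu> (\<lambda>x. f (t + x))) \<le> B * M"
    proof (cases "M = 0")
      case True
      then have "(\<lambda>x. f (t + x)) = (\<lambda>_. 0)"
        using M by simp
      then show ?thesis
        using complex_linear_on_C_c_zero[OF lin] True by simp
    next
      case False
      have "(\<lambda>x. f (t + x)) \<in> C_K ((\<lambda>k. - t + k) ` K)"
        using C_c_translate[OF fc(1), of t] fc(2) by (auto simp: C_K_def)
      then have "ennreal (cmod (\<mu> (\<lambda>x. f (t + x)))) \<le> ennreal M * variation \<mu> ((\<lambda>k. - t + k) ` K)"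
        using False \<open>0 \<le> M\<close> M by (intro cmod_le_variation[OF lin]) auto
      also have "\<dots> \<le> ennreal M * S"
        unfolding S_def by (intro mult_left_mono SUP_upper) auto
      also have "\<dots> = ennreal (B * M)"
        using B \<open>0 \<le> M\<close> by (simp add: ennreal_mult mult.commute)
      finally show ?thesis
        using B \<open>0 \<le> M\<close> by simp
    qed
  qed
qed

text \<open>For a test function on a group this is the sup norm of the convolution of
  \<open>\<mu>\<close> with the reflection of \<open>f\<close>. It serves as a common bound for all
  measures in the hull.\<close>

definition orbit_seminorm :: "(('g::plus \<Rightarrow> complex) \<Rightarrow> complex) \<Rightarrow> ('g \<Rightarrow> complex) \<Rightarrow> real" where
  "orbit_seminorm \<mu> f = (SUP t. cmod (\<mu> (\<lambda>x. f (t + x))))"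

context
  fixes \<mu> :: "('g::{topological_ab_group_add,t2_space} \<Rightarrow> complex) \<Rightarrow> complex"
  assumes lin: "complex_linear_on C_c \<mu>" and tb: "translation_bounded \<mu>"
begin

text \<open>Translation boundedness, applied to the compact support of \<open>f\<close>, bounds the
  family, so that the real supremum really is an upper bound.\<close>

lemma orbit_seminorm_upper:
  assumes "f \<in> C_c"
  shows "cmod (\<mu> (\<lambda>x. f (t + x))) \<le> orbit_seminorm \<mu> f"
proof -
  obtain M where M: "\<And>x. cmod (f x) \<le> M"
    using C_c_bounded[OF assms] by blast
  have "compact (supp f)" "f \<in> C_K (supp f)"
    using assms by (auto simp: C_K_def C_c_def)
  then obtain B where "\<And>t. cmod (\<mu> (\<lambda>x. f (t + x))) \<le> B * M"
    using translation_bounded_estimate[OF lin tb, of "supp f"] M by metis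
  then have "bdd_above (range (\<lambda>t. cmod (\<mu> (\<lambda>x. f (t + x)))))"
    by (auto simp: bdd_above_def)
  then show ?thesis
    unfolding orbit_seminorm_def by (rule cSUP_upper[rotated]) simp
qed

lemma orbit_seminorm_translate:
  assumes "f \<in> C_c"
  shows "orbit_seminorm \<mu> (\<lambda>x. f (s + x)) \<le> orbit_seminorm \<mu> f"
  unfolding orbit_seminorm_def[of \<mu> "\<lambda>x. f (s + x)"]
  using orbit_seminorm_upper[OF assms, of "s + t" for t] by (intro cSUP_least) (auto simp: add.assoc)

lemma seminorm_on_orbit_seminorm: "seminorm_on C_c (orbit_seminorm \<mu>)"
  unfolding seminorm_on_def
proof (intro conjI ballI allI)
  fix f g :: "'g \<Rightarrow> complex" assume fg: "f \<in> C_c" "g \<in> C_c"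
  have "cmod (\<mu> (\<lambda>x. f (t + x) + g (t + x))) \<le> orbit_seminorm \<mu> f + orbit_seminorm \<mu> g" for t
  proof -
    have eq: "\<mu> (\<lambda>x. f (t + x) + g (t + x)) = \<mu> (\<lambda>x. f (t + x)) + \<mu> (\<lambda>x. g (t + x))"
      by (rule complex_linear_onD(1)[OF lin C_c_translate(1)[OF fg(1)] C_c_translate(1)[OF fg(2)]])
    show ?thesis
      unfolding eq using orbit_seminorm_upper[OF fg(1), of t] orbit_seminorm_upper[OF fg(2), of t]
        norm_triangle_ineq[of "\<mu> (\<lambda>x. f (t + x))" "\<mu> (\<lambda>x. g (t + x))"] by linarith
  qed
  then show "orbit_seminorm \<mu> (\<lambda>x. f x + g x) \<le> orbit_seminorm \<mu> f + orbit_seminorm \<mu> g"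
    unfolding orbit_seminorm_def[of \<mu> "\<lambda>x. f x + g x"] by (intro cSUP_least) auto
next
  fix a and f :: "'g \<Rightarrow> complex" assume f: "f \<in> C_c"
  have eq: "cmod (\<mu> (\<lambda>x. a * f (t + x))) = cmod a * cmod (\<mu> (\<lambda>x. f (t + x)))" for t
  proof -
    have "\<mu> (\<lambda>x. a * f (t + x)) = a * \<mu> (\<lambda>x. f (t + x))"
      by (rule complex_linear_onD(2)[OF lin C_c_translate(1)[OF f]])
    then show ?thesis by (simp add: norm_mult)
  qed
  have "orbit_seminorm \<mu> (\<lambda>x. a * f x) \<le> cmod a * orbit_seminorm \<mu> f"
    unfolding orbit_seminorm_def[of \<mu> "\<lambda>x. a * f x"] eq
    using orbit_seminorm_upper[OF f] by (intro cSUP_least mult_left_mono) auto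
  \<comment> \<open>For nonzero \<open>a\<close> every term is divided by \<open>cmod a\<close>; for
    \<open>a = 0\<close> both sides vanish.\<close>
  moreover have "cmod a * orbit_seminorm \<mu> f \<le> orbit_seminorm \<mu> (\<lambda>x. a * f x)"
  proof (cases "a = 0")
    case True
    then show ?thesis
      using complex_linear_on_C_c_zero[OF lin] by (simp add: orbit_seminorm_def)
  next
    case False
    have "orbit_seminorm \<mu> f \<le> orbit_seminorm \<mu> (\<lambda>x. a * f x) / cmod a"
      unfolding orbit_seminorm_def[of \<mu> f]
    proof (rule cSUP_least)
      show "cmod (\<mu> (\<lambda>x. f (t + x))) \<le> orbit_seminorm \<mu> (\<lambda>x. a * f x) / cmod a" for t
        using orbit_seminorm_upper[OF C_c_mult[OF f, of a], of t] False eq[of t]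
        by (simp add: pos_le_divide_eq mult.commute)
    qed simp
    then show ?thesis
      using False by (simp add: pos_le_divide_eq mult.commute)
  qed
  ultimately show "orbit_seminorm \<mu> (\<lambda>x. a * f x) = cmod a * orbit_seminorm \<mu> f"
    by simp
qed

text \<open>The uniform constant for \<open>K\<close> makes the seminorm Lipschitz. Together with
  \<open>seminorm_on_orbit_seminorm\<close> this places it among the seminorms that generate the
  inductive limit topology.\<close>

lemma continuous_map_orbit_seminorm:
  assumes "compact K"
  shows "continuous_map (sup_norm_topology (C_K K)) euclidean (orbit_seminorm \<mu>)"
proof -
  obtain B where B: "\<And>f t M. \<lbrakk>f \<in> C_K K; \<And>x. cmod (f x) \<le> M\<rbrakk> \<Longrightarrow> cmod (\<mu> (\<lambda>x. f (t + x))) \<le> B * M"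
    by (rule translation_bounded_estimate[OF lin tb assms]) blast
  have half: "orbit_seminorm \<mu> f - orbit_seminorm \<mu> g \<le> B * M"
    if fg: "f \<in> C_K K" "g \<in> C_K K" and M: "\<And>x. dist (f x) (g x) \<le> M" for f g M
  proof -
    have fgc: "f \<in> C_c" "g \<in> C_c" "supp f \<subseteq> K" "supp g \<subseteq> K"
      using fg by (auto simp: C_K_def)
    define h where "h = (\<lambda>x. f x - g x)"
    have hc: "h \<in> C_c"
      unfolding h_def by (rule C_c_diff[OF fgc(1,2)])
    have "{x. h x \<noteq> 0} \<subseteq> K"
      using fgc(3,4) closure_subset[of "{x. f x \<noteq> 0}"] closure_subset[of "{x. g x \<noteq> 0}"]
      by (fastforce simp: h_def)
    then have "supp h \<subseteq> K"
      using compact_imp_closed[OF assms] by (rule closure_minimal)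
    with hc have "h \<in> C_K K"
      by (simp add: C_K_def)
    moreover have "cmod (h x) \<le> M" for x
      using M[of x] by (simp add: h_def dist_norm)
    ultimately have "orbit_seminorm \<mu> h \<le> B * M"
      unfolding orbit_seminorm_def using B by (intro cSUP_least) auto
    moreover have "orbit_seminorm \<mu> (\<lambda>x. h x + g x) \<le> orbit_seminorm \<mu> h + orbit_seminorm \<mu> g"
      using seminorm_on_orbit_seminorm hc fgc(2) by (simp add: seminorm_on_def)
    ultimately show ?thesis
      by (simp add: h_def)
  qed
  show ?thesis
  proof (rule continuous_map_sup_norm_topology)
    fix f g M assume fg: "f \<in> C_K K" "g \<in> C_K K" and M: "\<And>x. dist (f x) (g x) \<le> M"
    have M': "\<And>x. dist (g x) (f x) \<le> M"
      using M by (simp add: dist_commute)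
    show "dist (orbit_seminorm \<mu> f) (orbit_seminorm \<mu> g) \<le> B * M"
      using half[OF fg M] half[OF fg(2,1) M'] by (simp add: dist_real_def)
  qed
qed

text \<open>A vaguely compact set that will contain the hull. Continuity is not demanded because the
  bound implies it, and without it the set is cut out of a product of discs by closed
  conditions.\<close>

definition dominated :: "(('g \<Rightarrow> complex) \<Rightarrow> complex) set" where
  "dominated = {\<nu> \<in> extensional C_c. complex_linear_on C_c \<nu> \<and>
     (\<forall>f\<in>C_c. cmod (\<nu> f) \<le> orbit_seminorm \<mu> f)}"

text \<open>A ball of \<open>orbit_seminorm \<mu>\<close> with radius \<open>r\<close> is open in
  the inductive limit topology, and by linearity a dominated functional varies by less than
  \<open>r\<close> from its value at the centre.\<close>

lemma dominated_subset_radon_measures: "dominated \<subseteq> radon_measures"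
proof
  fix \<nu> assume "\<nu> \<in> dominated"
  then have ext: "\<nu> \<in> extensional C_c" and lin\<nu>: "complex_linear_on C_c \<nu>"
    and dom: "\<And>f. f \<in> C_c \<Longrightarrow> cmod (\<nu> f) \<le> orbit_seminorm \<mu> f"
    by (auto simp: dominated_def)
  let ?B = "\<lambda>f r. {g \<in> C_c. orbit_seminorm \<mu> (\<lambda>x. g x - f x) < r}"
  have "openin inductive_limit_topology (?B f r)" if "f \<in> C_c" for f r
    unfolding inductive_limit_topology_def
  proof (rule topology_generated_by_Basis, rule CollectI, intro exI conjI)
    \<comment> \<open>This trivial equation fixes the seminorm, the centre and the radius as
      witnesses.\<close>
    show "?B f r = ?B f r" ..
  qed (use that seminorm_on_orbit_seminorm continuous_map_orbit_seminorm in blast)+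
  then have nbhd: "\<exists>T. openin inductive_limit_topology T \<and> f \<in> T \<and> (\<forall>g\<in>T. g \<in> C_c \<and> dist (\<nu> f) (\<nu> g) < r)"
    if "f \<in> C_c" "r > 0" for f r
  proof (intro exI[of _ "?B f r"] conjI)
    show "f \<in> ?B f r"
      using that complex_linear_on_C_c_zero[OF lin] by (simp add: orbit_seminorm_def)
    show "\<forall>g\<in>?B f r. g \<in> C_c \<and> dist (\<nu> f) (\<nu> g) < r"
    proof
      fix g assume g: "g \<in> ?B f r"
      then have "dist (\<nu> g) (\<nu> f) \<le> orbit_seminorm \<mu> (\<lambda>x. g x - f x)"
        using dom[OF C_c_diff, of g f] complex_linear_on_C_c_diff[OF lin\<nu>, of g f] that
        by (simp add: dist_norm)
      then show "g \<in> C_c \<and> dist (\<nu> f) (\<nu> g) < r"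
        using g by (simp add: dist_commute)
    qed
  qed (use that in blast)
  have top: "topspace (inductive_limit_topology :: ('g \<Rightarrow> complex) topology) = C_c"
  proof
    show "topspace (inductive_limit_topology :: ('g \<Rightarrow> complex) topology) \<subseteq> C_c"
      unfolding inductive_limit_topology_def topology_generated_by_topspace by (rule Union_least) auto
    show "C_c \<subseteq> topspace (inductive_limit_topology :: ('g \<Rightarrow> complex) topology)"
    proof
      fix f :: "'g \<Rightarrow> complex" assume "f \<in> C_c"
      then obtain T where "openin inductive_limit_topology T" "f \<in> T"
        using nbhd[of f 1] by auto
      then show "f \<in> topspace inductive_limit_topology"
        using openin_subset by blast
    qed
  qed
  have "continuous_map inductive_limit_topology euclidean \<nu>"
    unfolding continuous_map_def top
  proof (intro conjI allI impI)
    fix U :: "complex set" assume "openin euclidean U"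
    then have "open U" by simp
    show "openin inductive_limit_topology {f \<in> C_c. \<nu> f \<in> U}"
    proof (subst openin_subopen, intro ballI)
      fix f assume f: "f \<in> {f \<in> C_c. \<nu> f \<in> U}"
      then obtain r where r: "r > 0" "ball (\<nu> f) r \<subseteq> U"
        using \<open>open U\<close> open_contains_ball by blast
      obtain T where T: "openin inductive_limit_topology T" "f \<in> T" "\<forall>g\<in>T. g \<in> C_c \<and> dist (\<nu> f) (\<nu> g) < r"
        using nbhd[of f r] f r by auto
      then have "T \<subseteq> {f \<in> C_c. \<nu> f \<in> U}"
        using r(2) by auto
      with T show "\<exists>T. openin inductive_limit_topology T \<and> f \<in> T \<and> T \<subseteq> {f \<in> C_c. \<nu> f \<in> U}"
        by blast
    qed
  qed simp
  then show "\<nu> \<in> radon_measures"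
    using ext lin\<nu> by (simp add: radon_measures_def)
qed

lemma translate_measure_dominated:
  assumes "\<nu> \<in> dominated"
  shows "translate_measure t \<nu> \<in> dominated"
proof -
  have lin\<nu>: "complex_linear_on C_c \<nu>" and dom: "\<And>f. f \<in> C_c \<Longrightarrow> cmod (\<nu> f) \<le> orbit_seminorm \<mu> f"
    using assms by (auto simp: dominated_def)
  have "complex_linear_on C_c (translate_measure t \<nu>)"
    unfolding complex_linear_on_def translate_measure_def
    using complex_linear_onD[OF lin\<nu>] by (auto simp: C_c_add C_c_mult C_c_translate(1))
  moreover have "cmod (\<nu> (\<lambda>x. f (t + x))) \<le> orbit_seminorm \<mu> f" if "f \<in> C_c" for f
    using dom[OF C_c_translate(1)[OF that]] orbit_seminorm_translate[OF that] order_trans by blast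
  ultimately show ?thesis
    by (simp add: dominated_def translate_measure_def)
qed

end

section \<open>The vague topology\<close>

lemma topspace_vague_topology: "topspace (vague_topology :: (('g::topological_space \<Rightarrow> complex) \<Rightarrow> complex) topology) = radon_measures"
proof
  show "topspace (vague_topology :: (('g \<Rightarrow> complex) \<Rightarrow> complex) topology) \<subseteq> radon_measures"
    unfolding vague_topology_def topology_generated_by_topspace by (rule Union_least) auto
  have "(radon_measures :: (('g \<Rightarrow> complex) \<Rightarrow> complex) set) \<in>
      {{\<mu> \<in> radon_measures. \<mu> f \<in> U} | f U. f \<in> C_c \<and> open U}"
    by (rule CollectI, rule exI[of _ "\<lambda>_. 0"], rule exI[of _ UNIV]) (simp add: zero_in_C_c)
  then show "radon_measures \<subseteq> topspace (vague_topology :: (('g \<Rightarrow> complex) \<Rightarrow> complex) topology)"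
    unfolding vague_topology_def topology_generated_by_topspace by (rule Union_upper)
qed

section \<open>Vague neighbourhoods given by finitely many test functions\<close>

lemma openin_vague_topology_basic:
  fixes F :: "('g::topological_space \<Rightarrow> complex) set"
  assumes "finite F" "F \<subseteq> C_c"
  shows "openin vague_topology {\<nu> \<in> radon_measures. \<forall>f\<in>F. dist (\<nu> f) (a f) < e}"
  using assms
proof (induction F rule: finite_induct)
  case empty
  then show ?case
    using openin_topspace[of vague_topology] by (simp add: topspace_vague_topology)
next
  case (insert f F)
  have "openin vague_topology {\<nu> \<in> radon_measures. \<nu> f \<in> ball (a f) e}"
    unfolding vague_topology_def
    by (rule topology_generated_by_Basis, rule CollectI, rule exI[of _ f], rule exI[of _ "ball (a f) e"])
      (use insert.prems in simp)
  moreover have "openin vague_topology {\<nu> \<in> radon_measures. \<forall>f\<in>F. dist (\<nu> f) (a f) < e}"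
    using insert by simp
  ultimately have "openin vague_topology ({\<nu> \<in> radon_measures. \<nu> f \<in> ball (a f) e} \<inter>
      {\<nu> \<in> radon_measures. \<forall>f\<in>F. dist (\<nu> f) (a f) < e})"
    by (rule openin_Int)
  moreover have "{\<nu> \<in> radon_measures. \<nu> f \<in> ball (a f) e} \<inter>
      {\<nu> \<in> radon_measures. \<forall>f\<in>F. dist (\<nu> f) (a f) < e} =
      {\<nu> \<in> radon_measures. \<forall>f\<in>insert f F. dist (\<nu> f) (a f) < e}"
    by (auto simp: dist_commute)
  ultimately show ?case by simp
qed

lemma openin_vague_topology_nbhd:
  fixes U :: "(('g::topological_space \<Rightarrow> complex) \<Rightarrow> complex) set"
  assumes "openin vague_topology U" "\<nu> \<in> U"
  shows "\<exists>F e. finite F \<and> F \<subseteq> C_c \<and> e > 0 \<and> (\<forall>\<sigma>\<in>radon_measures. (\<forall>f\<in>F. dist (\<sigma> f) (\<nu> f) < e) \<longrightarrow> \<sigma> \<in> U)"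
proof -
  have "generate_topology_on {{\<mu> \<in> radon_measures. \<mu> f \<in> U} | f U. f \<in> C_c \<and> open U} U"
    using assms(1) unfolding vague_topology_def by (rule openin_topology_generated_by)
  then show ?thesis
    using assms(2)
  proof (induction arbitrary: \<nu> rule: generate_topology_on.induct)
    case Empty
    then show ?case by simp
  next
    case (Int V W)
    obtain F e where F: "finite F" "F \<subseteq> C_c" "e > 0"
        "\<And>\<sigma>. \<sigma> \<in> radon_measures \<Longrightarrow> (\<forall>f\<in>F. dist (\<sigma> f) (\<nu> f) < e) \<Longrightarrow> \<sigma> \<in> V"
      using Int.IH(1)[of \<nu>] Int.prems by auto
    obtain F' e' where F': "finite F'" "F' \<subseteq> C_c" "e' > 0"
        "\<And>\<sigma>. \<sigma> \<in> radon_measures \<Longrightarrow> (\<forall>f\<in>F'. dist (\<sigma> f) (\<nu> f) < e') \<Longrightarrow> \<sigma> \<in> W"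
      using Int.IH(2)[of \<nu>] Int.prems by auto
    show ?case
      using F F' by (intro exI[of _ "F \<union> F'"] exI[of _ "min e e'"]) auto
  next
    case (UN K)
    then obtain V where V: "V \<in> K" "\<nu> \<in> V" by auto
    then obtain F e where F: "finite F" "F \<subseteq> C_c" "e > 0"
        "\<And>\<sigma>. \<sigma> \<in> radon_measures \<Longrightarrow> (\<forall>f\<in>F. dist (\<sigma> f) (\<nu> f) < e) \<Longrightarrow> \<sigma> \<in> V"
      using UN.IH[of V \<nu>] by auto
    show ?case
      using F V by (intro exI[of _ F] exI[of _ e]) auto
  next
    case (Basis V)
    then obtain f O' where V: "V = {\<mu> \<in> radon_measures. \<mu> f \<in> O'}" "f \<in> C_c" "open O'" by auto
    then obtain e where "e > 0" "ball (\<nu> f) e \<subseteq> O'"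
      using Basis.prems open_contains_ball by blast
    then show ?case
      using V by (intro exI[of _ "{f}"] exI[of _ e]) (auto simp: dist_commute subset_iff)
  qed
qed

lemma in_vague_closure_iff:
  fixes A :: "(('g::topological_space \<Rightarrow> complex) \<Rightarrow> complex) set"
  assumes "A \<subseteq> radon_measures"
  shows "\<nu> \<in> vague_topology closure_of A \<longleftrightarrow> \<nu> \<in> radon_measures \<and>
    (\<forall>F e. finite F \<and> F \<subseteq> C_c \<and> e > 0 \<longrightarrow> (\<exists>\<sigma>\<in>A. \<forall>f\<in>F. dist (\<sigma> f) (\<nu> f) < e))"
    (is "?l \<longleftrightarrow> ?r")
proof
  assume l: ?l
  then have rad: "\<nu> \<in> radon_measures"
    by (simp add: in_closure_of topspace_vague_topology)
  moreover have "\<exists>\<sigma>\<in>A. \<forall>f\<in>F. dist (\<sigma> f) (\<nu> f) < e" if F: "finite F" "F \<subseteq> C_c" "e > 0" for F e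
  proof -
    have "openin vague_topology {\<sigma> \<in> radon_measures. \<forall>f\<in>F. dist (\<sigma> f) (\<nu> f) < e}"
      using F by (intro openin_vague_topology_basic)
    moreover have "\<nu> \<in> {\<sigma> \<in> radon_measures. \<forall>f\<in>F. dist (\<sigma> f) (\<nu> f) < e}"
      using rad F by simp
    ultimately obtain \<sigma> where "\<sigma> \<in> A" "\<sigma> \<in> {\<sigma> \<in> radon_measures. \<forall>f\<in>F. dist (\<sigma> f) (\<nu> f) < e}"
      using l unfolding in_closure_of by meson
    then show ?thesis by auto
  qed
  ultimately show ?r by blast
next
  assume r: ?r
  show ?l
    unfolding in_closure_of topspace_vague_topology
  proof (intro conjI allI impI)
    fix T assume T: "\<nu> \<in> T \<and> openin vague_topology T"
    obtain F e where F: "finite F" "F \<subseteq> C_c" "e > 0"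
        "\<And>\<sigma>. \<sigma> \<in> radon_measures \<Longrightarrow> (\<forall>f\<in>F. dist (\<sigma> f) (\<nu> f) < e) \<Longrightarrow> \<sigma> \<in> T"
      using openin_vague_topology_nbhd[of T \<nu>] T by auto
    then obtain \<sigma> where "\<sigma> \<in> A" "\<forall>f\<in>F. dist (\<sigma> f) (\<nu> f) < e"
      using r by meson
    then show "\<exists>y. y \<in> A \<and> y \<in> T"
      using F(4)[of \<sigma>] assms by auto
  qed (use r in simp)
qed

text \<open>A Banach-Alaoglu argument: the bounds give a compact product of discs, linearity cuts
  out a closed subset, and the result is carried over to the vague topology.\<close>

lemma compactin_dominated:
  fixes \<mu> :: "('g::{topological_ab_group_add,t2_space} \<Rightarrow> complex) \<Rightarrow> complex"
  assumes lin: "complex_linear_on C_c \<mu>" and tb: "translation_bounded \<mu>"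
  shows "compactin vague_topology (dominated \<mu>)"
proof -
  let ?C = "C_c :: ('g \<Rightarrow> complex) set"
  define X where "X = product_topology (\<lambda>_. euclidean :: complex topology) ?C"
  define P where "P = PiE ?C (\<lambda>f. cball (0 :: complex) (orbit_seminorm \<mu> f))"
  define A where "A = (\<lambda>f g. {p \<in> topspace X. p (\<lambda>x. f x + g x) = p f + p g})"
  define H where "H = (\<lambda>a f. {p \<in> topspace X. p (\<lambda>x. a * f x) = a * p f})"
  have ne: "?C \<noteq> {}"
    using zero_in_C_c by blast
  have coord: "continuous_map X euclidean (\<lambda>p. p f)" if "f \<in> ?C" for f
    unfolding X_def using that by (rule continuous_map_product_coordinates)
  have clA: "closedin X (A f g)" if "f \<in> ?C" "g \<in> ?C" for f g
    unfolding A_def using that C_c_add[OF that]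
    by (intro closedin_continuous_maps_eq[of euclidean] continuous_map_add coord) auto
  have clH: "closedin X (H a f)" if "f \<in> ?C" for a f
    unfolding H_def using that C_c_mult[OF that]
    by (intro closedin_continuous_maps_eq[of euclidean] continuous_map_complex_mult_left coord) auto
  have "compactin X P"
    by (auto simp: X_def P_def compactin_PiE)
  moreover have "closedin X ((\<Inter>f\<in>?C. \<Inter>g\<in>?C. A f g) \<inter> (\<Inter>a. \<Inter>f\<in>?C. H a f))"
    using ne by (intro closedin_Int closedin_INT clA clH) auto
  ultimately have comp: "compactin X (P \<inter> ((\<Inter>f\<in>?C. \<Inter>g\<in>?C. A f g) \<inter> (\<Inter>a. \<Inter>f\<in>?C. H a f)))"
    by (rule compact_Int_closedin)
  have "P \<inter> ((\<Inter>f\<in>?C. \<Inter>g\<in>?C. A f g) \<inter> (\<Inter>a. \<Inter>f\<in>?C. H a f)) = dominated \<mu>"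
  proof (intro equalityI subsetI)
    fix p assume p: "p \<in> P \<inter> ((\<Inter>f\<in>?C. \<Inter>g\<in>?C. A f g) \<inter> (\<Inter>a. \<Inter>f\<in>?C. H a f))"
    then have "complex_linear_on ?C p"
      by (simp add: complex_linear_on_def A_def H_def)
    moreover have "p \<in> extensional ?C" "\<forall>f\<in>?C. cmod (p f) \<le> orbit_seminorm \<mu> f"
      using p by (auto simp: P_def PiE_iff)
    ultimately show "p \<in> dominated \<mu>"
      by (simp add: dominated_def[OF lin tb])
  next
    fix p assume "p \<in> dominated \<mu>"
    then have p: "p \<in> extensional ?C" "complex_linear_on ?C p" "\<forall>f\<in>?C. cmod (p f) \<le> orbit_seminorm \<mu> f"
      by (auto simp: dominated_def[OF lin tb])
    then have "p \<in> P" "p \<in> topspace X"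
      by (auto simp: P_def X_def PiE_iff)
    then show "p \<in> P \<inter> ((\<Inter>f\<in>?C. \<Inter>g\<in>?C. A f g) \<inter> (\<Inter>a. \<Inter>f\<in>?C. H a f))"
      using complex_linear_onD[OF p(2)] by (simp add: A_def H_def)
  qed
  with comp have comp: "compactin X (dominated \<mu>)" by simp
  have topS: "topspace (subtopology X (dominated \<mu>)) = dominated \<mu>"
    using compactin_subset_topspace[OF comp] by (auto simp: topspace_subtopology)
  have rad: "dominated \<mu> \<subseteq> radon_measures"
    by (rule dominated_subset_radon_measures[OF lin tb])
  \<comment> \<open>On dominated functionals the identity is continuous from pointwise convergence
    on \<open>C_c\<close> to the vague topology, which transfers compactness.\<close>
  have "continuous_map (subtopology X (dominated \<mu>)) vague_topology id"
    unfolding vague_topology_def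
  proof (rule continuous_on_generated_topo)
    fix U assume "U \<in> {{\<nu> \<in> radon_measures. \<nu> f \<in> U} | f U. f \<in> ?C \<and> open U}"
    then obtain f O' where U: "U = {\<nu> \<in> radon_measures. \<nu> f \<in> O'}" "f \<in> ?C" "open O'" by auto
    have "openin (subtopology X (dominated \<mu>)) {p \<in> topspace (subtopology X (dominated \<mu>)). p f \<in> O'}"
      using U by (intro openin_continuous_map_preimage[OF continuous_map_from_subtopology[OF coord]]) auto
    moreover have "id -` U \<inter> topspace (subtopology X (dominated \<mu>)) = {p \<in> topspace (subtopology X (dominated \<mu>)). p f \<in> O'}"
      using rad unfolding topS U(1) by auto
    ultimately show "openin (subtopology X (dominated \<mu>)) (id -` U \<inter> topspace (subtopology X (dominated \<mu>)))"
      by simp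
  next
    have "\<Union>{{\<nu> \<in> radon_measures. \<nu> f \<in> U} | f U. f \<in> ?C \<and> open U} = radon_measures"
      using topspace_vague_topology[where 'g = 'g] unfolding vague_topology_def topology_generated_by_topspace .
    then show "id ` topspace (subtopology X (dominated \<mu>)) \<subseteq> \<Union>{{\<nu> \<in> radon_measures. \<nu> f \<in> U} | f U. f \<in> ?C \<and> open U}"
      unfolding topS using rad by simp
  qed
  then have "compactin vague_topology (id ` dominated \<mu>)"
    using comp by (intro image_compactin) (auto simp: compactin_subtopology)
  then show ?thesis by simp
qed

section \<open>The hull\<close>

lemma translate_measure_apply: "f \<in> C_c \<Longrightarrow> translate_measure t \<mu> f = \<mu> (\<lambda>x. f (t + x))"
  by (simp add: translate_measure_def)

lemma in_orbit_closure_iff: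
  assumes "orbit \<nu> \<subseteq> radon_measures"
  shows "\<eta> \<in> vague_topology closure_of orbit \<nu> \<longleftrightarrow> \<eta> \<in> radon_measures \<and>
    (\<forall>F e. finite F \<and> F \<subseteq> C_c \<and> e > 0 \<longrightarrow> (\<exists>t. \<forall>f\<in>F. dist (\<nu> (\<lambda>x. f (t + x))) (\<eta> f) < e))"
proof -
  have "(\<exists>\<sigma>\<in>orbit \<nu>. \<forall>f\<in>F. dist (\<sigma> f) (\<eta> f) < e) \<longleftrightarrow> (\<exists>t. \<forall>f\<in>F. dist (\<nu> (\<lambda>x. f (t + x))) (\<eta> f) < e)"
    if "F \<subseteq> C_c" for F e
    using that by (auto simp: orbit_def translate_measure_apply subset_iff)
  then show ?thesis
    unfolding in_vague_closure_iff[OF assms] by meson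
qed

context
  fixes \<mu> :: "('g::{topological_ab_group_add,t2_space} \<Rightarrow> complex) \<Rightarrow> complex"
  assumes rad: "\<mu> \<in> radon_measures" and tb: "translation_bounded \<mu>"
begin

lemma linear_on_C_c: "complex_linear_on C_c \<mu>"
  using rad by (simp add: radon_measures_def)

lemma orbit_subset_dominated:
  assumes "\<nu> \<in> dominated \<mu>"
  shows "orbit \<nu> \<subseteq> dominated \<mu>"
  using translate_measure_dominated[OF linear_on_C_c tb assms] by (auto simp: orbit_def)

lemma mem_dominated: "\<mu> \<in> dominated \<mu>"
  using rad orbit_seminorm_upper[OF linear_on_C_c tb, of _ 0]
  by (auto simp: dominated_def[OF linear_on_C_c tb] radon_measures_def)

lemma orbit_subset_radon_measures:
  assumes "\<nu> \<in> dominated \<mu>"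
  shows "orbit \<nu> \<subseteq> radon_measures"
  using orbit_subset_dominated[OF assms] dominated_subset_radon_measures[OF linear_on_C_c tb] by (rule order_trans)

lemma in_hull_iff:
  "\<nu> \<in> hull_of \<mu> \<longleftrightarrow> \<nu> \<in> radon_measures \<and>
    (\<forall>F e. finite F \<and> F \<subseteq> C_c \<and> e > 0 \<longrightarrow> (\<exists>t. \<forall>f\<in>F. dist (\<mu> (\<lambda>x. f (t + x))) (\<nu> f) < e))"
  unfolding hull_of_def by (rule in_orbit_closure_iff[OF orbit_subset_radon_measures[OF mem_dominated]])

text \<open>The bound holds along the orbit of \<open>\<mu>\<close> and passes to vague limits, one
  test function at a time.\<close>

lemma hull_subset_dominated: "hull_of \<mu> \<subseteq> dominated \<mu>"
proof
  fix \<nu> assume \<nu>: "\<nu> \<in> hull_of \<mu>"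
  then have "\<nu> \<in> radon_measures"
    by (simp add: in_hull_iff)
  moreover have "cmod (\<nu> f) \<le> orbit_seminorm \<mu> f" if f: "f \<in> C_c" for f
  proof (rule field_le_epsilon)
    fix e :: real assume "e > 0"
    then obtain t where t: "dist (\<mu> (\<lambda>x. f (t + x))) (\<nu> f) < e"
      using \<nu> f unfolding in_hull_iff by (elim conjE allE[of _ "{f}"] allE[of _ e]) auto
    then show "cmod (\<nu> f) \<le> orbit_seminorm \<mu> f + e"
      using orbit_seminorm_upper[OF linear_on_C_c tb f, of t]
        norm_triangle_ineq2[of "\<nu> f" "\<mu> (\<lambda>x. f (t + x))"]
      by (simp add: dist_norm norm_minus_commute)
  qed
  ultimately show "\<nu> \<in> dominated \<mu>"
    by (simp add: dominated_def[OF linear_on_C_c tb] radon_measures_def)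
qed

lemma compactin_hull: "compactin vague_topology (hull_of \<mu>)"
  using compactin_dominated[OF linear_on_C_c tb] hull_subset_dominated
  by (rule closed_compactin) (simp add: hull_of_def)

lemma orbit_subset_hull:
  assumes \<nu>: "\<nu> \<in> hull_of \<mu>"
  shows "orbit \<nu> \<subseteq> hull_of \<mu>"
proof
  fix \<eta> assume "\<eta> \<in> orbit \<nu>"
  then obtain s where s: "\<eta> = translate_measure s \<nu>"
    by (auto simp: orbit_def)
  have "\<eta> \<in> radon_measures"
    using \<open>\<eta> \<in> orbit \<nu>\<close> orbit_subset_radon_measures \<nu> hull_subset_dominated by blast
  moreover have "\<exists>t. \<forall>f\<in>F. dist (\<mu> (\<lambda>x. f (t + x))) (\<eta> f) < e" if F: "finite F" "F \<subseteq> C_c" "e > 0" for F e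
  proof -
    \<comment> \<open>The translation by \<open>s\<close> is moved onto the test functions: a
      translate of \<open>\<mu>\<close> by \<open>t\<close> close to \<open>\<nu>\<close> on
      \<open>G\<close> gives one by \<open>s + t\<close> close to \<open>\<eta>\<close> on
      \<open>F\<close>.\<close>
    define G where "G = (\<lambda>f x. f (s + x)) ` F"
    have "finite G" "G \<subseteq> C_c"
      using F by (auto simp: G_def intro: C_c_translate(1))
    then obtain t where "\<forall>g\<in>G. dist (\<mu> (\<lambda>x. g (t + x))) (\<nu> g) < e"
      using \<nu> \<open>e > 0\<close> unfolding in_hull_iff by blast
    then have "\<forall>f\<in>F. dist (\<mu> (\<lambda>x. f (s + t + x))) (\<eta> f) < e"
      using F(2) by (auto simp: G_def s translate_measure_apply add.assoc subset_iff)
    then show ?thesis by blast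
  qed
  ultimately show "\<eta> \<in> hull_of \<mu>"
    unfolding in_hull_iff by blast
qed

lemma orbit_subset_hull_self: "orbit \<mu> \<subseteq> hull_of \<mu>"
  using orbit_subset_radon_measures[OF mem_dominated]
  by (simp add: hull_of_def closure_of_subset topspace_vague_topology)

text \<open>Orbits of points of the hull stay in the hull, so the relative closure is the vague
  closure cut down to the hull, and only one inclusion remains.\<close>

lemma minimal_hull_iff:
  "minimal_hull \<mu> \<longleftrightarrow> (\<forall>\<nu>\<in>hull_of \<mu>. hull_of \<mu> \<subseteq> vague_topology closure_of orbit \<nu>)"
proof -
  have "subtopology vague_topology (hull_of \<mu>) closure_of (orbit \<nu>) =
      hull_of \<mu> \<inter> vague_topology closure_of orbit \<nu>" if "\<nu> \<in> hull_of \<mu>" for \<nu>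
    using orbit_subset_hull[OF that] by (simp add: closure_of_subtopology Int_absorb1)
  then show ?thesis
    unfolding minimal_hull_def by (simp add: Int_absorb2 inf.order_iff eq_commute)
qed

end

section \<open>Bohr almost periodicity as total boundedness\<close>

lemma translate_fun_in_C_u:
  assumes "f \<in> C_u"
  shows "translate_fun t f \<in> C_u"
proof -
  have "range (translate_fun t f) \<subseteq> range f"
    by (auto simp: translate_fun_def)
  then have "bounded (range (translate_fun t f))"
    using assms bounded_subset by (auto simp: C_u_def)
  moreover have "\<exists>U. open U \<and> 0 \<in> U \<and> (\<forall>x y. x - y \<in> U \<longrightarrow> dist (translate_fun t f x) (translate_fun t f y) < e)"
    if e: "e > 0" for e
  proof -
    obtain U where "open U" "0 \<in> U" "\<And>x y. x - y \<in> U \<Longrightarrow> dist (f x) (f y) < e"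
      using assms e unfolding C_u_def by blast
    then show ?thesis
      by (intro exI[of _ U]) (simp add: translate_fun_def)
  qed
  ultimately show ?thesis
    by (simp add: C_u_def)
qed

lemma C_u_uniform_limit:
  assumes "bounded (range l)" and approx: "\<And>e. e > 0 \<Longrightarrow> \<exists>f\<in>C_u. \<forall>x. dist (f x) (l x) \<le> e"
  shows "l \<in> C_u"
proof -
  have "\<exists>U. open U \<and> 0 \<in> U \<and> (\<forall>x y. x - y \<in> U \<longrightarrow> dist (l x) (l y) < e)" if e: "e > 0" for e
  proof -
    obtain f where f: "f \<in> C_u" "\<And>x. dist (f x) (l x) \<le> e / 3"
      using approx[of "e / 3"] e by auto
    then obtain U where U: "open U" "0 \<in> U" "\<And>x y. x - y \<in> U \<Longrightarrow> dist (f x) (f y) < e / 3"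
      using e unfolding C_u_def by (auto dest!: spec[of _ "e / 3"])
    have "dist (l x) (l y) < e" if "x - y \<in> U" for x y
      using U(3)[OF that] f(2)[of x] f(2)[of y] dist_triangle[of "l x" "l y" "f x"]
        dist_triangle[of "f x" "l y" "f y"] by (simp add: dist_commute)
    then show ?thesis
      using U by blast
  qed
  then show ?thesis
    using assms(1) by (simp add: C_u_def)
qed

text \<open>Uniform limits stay in \<open>C_u\<close>, which is therefore closed in the complete
  space of bounded functions.\<close>

lemma mcomplete_C_u:
  "Metric_space.mcomplete (mspace (submetric (funspace UNIV euclidean_metric) C_u))
     (mdist (submetric (funspace UNIV (euclidean_metric :: complex metric)) C_u))"
proof -
  let ?m = "funspace UNIV euclidean_metric :: ('g::topological_ab_group_add \<Rightarrow> complex) metric"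
  interpret F: Metric_space "mspace ?m" "mdist ?m"
    by (rule Metric_space_mspace_mdist)
  interpret S: Submetric "mspace ?m" "mdist ?m" "C_u \<inter> mspace ?m"
    by unfold_locales auto
  have "mcomplete_of (funspace (UNIV :: 'g set) (euclidean_metric :: complex metric))"
    unfolding euclidean_metric_def Met_TC.Self_def[symmetric]
    by (rule Met_TC.mcomplete_funspace) (simp add: complete_UNIV)
  then have "Metric_space.mcomplete (mspace ?m) (mdist ?m)"
    by (simp add: mcomplete_of_def del: mdist_funspace mspace_funspace)
  then have "Metric_space.mcomplete (C_u \<inter> mspace ?m) (mdist ?m)"
  proof (rule S.sequentially_closedin_mcomplete_imp_mcomplete)
    fix \<sigma> l assume \<sigma>: "range \<sigma> \<subseteq> C_u \<inter> mspace ?m \<and> limitin F.mtopology \<sigma> l sequentially"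
    then have l: "l \<in> mspace ?m" and lim: "\<And>e. e > 0 \<Longrightarrow> eventually (\<lambda>n. mdist ?m (\<sigma> n) l < e) sequentially"
      by (auto simp: F.limitin_metric eventually_conj_iff simp del: mdist_funspace mspace_funspace)
    have bdd: "bounded (range l)"
      using l by (simp add: Met_TC.fspace_def)
    have "l \<in> C_u"
      using bdd
    proof (rule C_u_uniform_limit)
      fix e :: real assume "e > 0"
      then obtain n where "mdist ?m (\<sigma> n) l < e"
        using eventually_happens[OF lim] by auto
      moreover have "\<sigma> n \<in> C_u" "bounded (range (\<sigma> n))"
        using \<sigma> bounded_C_u by auto
      ultimately show "\<exists>f\<in>C_u. \<forall>x. dist (f x) (l x) \<le> e"
        using mdist_funspace_le_iff[of "\<sigma> n" l e] bdd by (auto simp del: mdist_funspace)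
    qed
    then show "l \<in> C_u \<inter> mspace ?m"
      using l by blast
  qed
  then show ?thesis
    by (simp del: mdist_funspace mspace_funspace)
qed

text \<open>By completeness of \<open>C_u\<close>, compact closure of the orbit is the same as total
  boundedness, with net centres taken from the orbit itself.\<close>

lemma bohr_almost_periodic_iff_net:
  assumes f: "f \<in> C_u"
  shows "bohr_almost_periodic f \<longleftrightarrow>
    (\<forall>e>0. \<exists>N. finite N \<and> (\<forall>t. \<exists>s\<in>N. \<forall>x. dist (f (x - t)) (f (x - s)) \<le> e))"
proof -
  let ?m = "submetric (funspace UNIV euclidean_metric) C_u :: ('a \<Rightarrow> complex) metric"
  let ?R = "range (\<lambda>t. translate_fun t f)"
  interpret M: Metric_space "mspace ?m" "mdist ?m"
    by (rule Metric_space_mspace_mdist)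
  have R: "translate_fun t f \<in> mspace ?m" for t
    using translate_fun_in_C_u[OF f, of t] bounded_C_u by (auto simp: Met_TC.fspace_def)
  have bR: "bounded (range (translate_fun t f))" for t
    using translate_fun_in_C_u[OF f, of t] by (rule bounded_C_u)
  have dist_iff: "mdist ?m (translate_fun s f) (translate_fun t f) \<le> e \<longleftrightarrow>
      (\<forall>x. dist (f (x - s)) (f (x - t)) \<le> e)" for s t e
    using mdist_funspace_le_iff[OF bR[of s] bR[of t], of e]
    by (simp add: translate_fun_def del: mdist_funspace)
  have "Metric_space.mcomplete (mspace ?m) (mdist ?m)"
    by (rule mcomplete_C_u)
  then have "bohr_almost_periodic f \<longleftrightarrow> M.mtotally_bounded ?R"
    unfolding bohr_almost_periodic_def precompact_in_def sup_norm_topology_def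
    using f by (simp add: M.mtotally_bounded_eq_compact_closure_of mtopology_of_def
        del: mdist_funspace mspace_funspace mspace_submetric mdist_submetric)
  also have "\<dots> \<longleftrightarrow> (\<forall>e>0. \<exists>N. finite N \<and> (\<forall>t. \<exists>s\<in>N. \<forall>x. dist (f (x - t)) (f (x - s)) \<le> e))"
  proof (intro iffI allI impI)
    fix e :: real assume tot: "M.mtotally_bounded ?R" and "e > 0"
    obtain K where K: "finite K" "K \<subseteq> ?R" "?R \<subseteq> (\<Union>x\<in>K. M.mball x e)"
      using tot[unfolded M.mtotally_bounded_def, rule_format, OF \<open>e > 0\<close>] by (elim exE conjE)
    then obtain N where N: "finite N" "K = (\<lambda>t. translate_fun t f) ` N"
      by (meson finite_subset_image)
    have "\<exists>s\<in>N. \<forall>x. dist (f (x - t)) (f (x - s)) \<le> e" for t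
    proof -
      have "translate_fun t f \<in> (\<Union>x\<in>K. M.mball x e)"
        using K(3) by blast
      then obtain s where s: "s \<in> N" "translate_fun t f \<in> M.mball (translate_fun s f) e"
        unfolding N(2) by blast
      then have "mdist ?m (translate_fun t f) (translate_fun s f) \<le> e"
        unfolding M.in_mball by (simp add: M.commute del: mdist_funspace mspace_funspace mspace_submetric mdist_submetric)
      then show ?thesis
        using s(1) unfolding dist_iff by blast
    qed
    then show "\<exists>N. finite N \<and> (\<forall>t. \<exists>s\<in>N. \<forall>x. dist (f (x - t)) (f (x - s)) \<le> e)"
      using N(1) by blast
  next
    assume nets: "\<forall>e>0. \<exists>N. finite N \<and> (\<forall>t. \<exists>s\<in>N. \<forall>x. dist (f (x - t)) (f (x - s)) \<le> e)"
    show "M.mtotally_bounded ?R"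
      unfolding M.mtotally_bounded_def
    proof (intro allI impI)
      fix e :: real assume "e > 0"
      \<comment> \<open>The radius is halved because the nets use \<open>\<le>\<close> while the
        balls are open.\<close>
      then have "e / 2 > 0" by simp
      with nets obtain N where N: "finite N" "\<And>t. \<exists>s\<in>N. \<forall>x. dist (f (x - t)) (f (x - s)) \<le> e / 2"
        by blast
      have "?R \<subseteq> (\<Union>x\<in>(\<lambda>t. translate_fun t f) ` N. M.mball x e)"
      proof
        fix u assume "u \<in> ?R"
        then obtain t where t: "u = translate_fun t f" by blast
        obtain s where s: "s \<in> N" "mdist ?m (translate_fun t f) (translate_fun s f) \<le> e / 2"
          using N(2)[of t] unfolding dist_iff by blast
        then have "u \<in> M.mball (translate_fun s f) e"
          using R \<open>e > 0\<close> unfolding t M.in_mball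
          by (simp add: M.commute del: mdist_funspace mspace_funspace mspace_submetric mdist_submetric)
        then show "u \<in> (\<Union>x\<in>(\<lambda>t. translate_fun t f) ` N. M.mball x e)"
          using s(1) by blast
      qed
      then show "\<exists>K. finite K \<and> K \<subseteq> ?R \<and> ?R \<subseteq> (\<Union>x\<in>K. M.mball x e)"
        using N(1) by (intro exI[of _ "(\<lambda>t. translate_fun t f) ` N"]) auto
    qed
  qed
  finally show ?thesis .
qed

section \<open>Minimality and strong almost periodicity\<close>

text \<open>Closeness of finitely many values of \<open>h\<close> is closeness of measures on
  finitely many test functions, so a pointwise open set of translates of \<open>h\<close> can be
  read as a vaguely open set of measures.\<close>

lemma minimal_hull_imp_bohr_almost_periodic:
  fixes \<mu> :: "('g::{topological_ab_group_add,t2_space} \<Rightarrow> complex) \<Rightarrow> complex"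
  assumes rad: "\<mu> \<in> radon_measures" and tb: "translation_bounded \<mu>" and c: "c \<in> C_c"
    and wap: "weakly_almost_periodic_fun (convolve c \<mu>)" and min: "minimal_hull \<mu>"
  shows "bohr_almost_periodic (convolve c \<mu>)"
proof -
  define h where "h = convolve c \<mu>"
  \<comment> \<open>The test function whose integral is \<open>h x\<close>; translating it only
    shifts the index, by \<open>dt\<close>.\<close>
  define d where "d = (\<lambda>x t. c (x - t))"
  have dc: "d x \<in> C_c" for x
    unfolding d_def by (rule C_c_reflect[OF c])
  have dt: "d x (t + y) = d (x - t) y" for x t y
    by (simp add: d_def algebra_simps)
  have h: "h x = \<mu> (d x)" for x
    by (simp add: h_def convolve_def d_def)
  have "h \<in> C_u"
    using wap by (simp add: h_def weakly_almost_periodic_fun_def)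
  moreover have "\<exists>N. finite N \<and> (\<forall>t. \<exists>s\<in>N. \<forall>x. dist (h (x - t)) (h (x - s)) \<le> e)" if e: "e > 0" for e
  proof -
    obtain V where V: "row_open (\<lambda>t x. h (x - t)) V" "V \<noteq> {}"
        and diam: "\<And>s t x. s \<in> V \<Longrightarrow> t \<in> V \<Longrightarrow> dist (h (x - s)) (h (x - t)) \<le> e"
      using weakly_almost_periodic_fun_fragmented[OF wap e] unfolding h_def by metis
    then obtain t0 where "t0 \<in> V" by blast
    then obtain F \<delta> where F: "finite F" "\<delta> > 0"
        "\<And>s. (\<forall>x\<in>F. dist (h (x - s)) (h (x - t0)) < \<delta>) \<Longrightarrow> s \<in> V"
      using V(1) unfolding row_open_def by meson
    \<comment> \<open>Measures whose translate by \<open>s\<close> is close to the translate of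
      \<open>\<mu>\<close> by \<open>t0\<close> on the functions \<open>d x\<close> with
      \<open>x\<close> in \<open>F\<close>. The shift by \<open>s\<close> sits in the test
      functions, hence the centre uses \<open>t0 - s\<close>.\<close>
    define W where "W = (\<lambda>s. {\<nu> \<in> radon_measures. \<forall>f\<in>(\<lambda>x. d (x - s)) ` F.
        dist (\<nu> f) (\<mu> (\<lambda>y. f (t0 - s + y))) < \<delta>})"
    have "(\<lambda>y. d (x - s) (t0 - s + y)) = d (x - t0)" for x s
      by (simp add: dt fun_eq_iff)
    then have W: "\<nu> \<in> W s \<longleftrightarrow> \<nu> \<in> radon_measures \<and> (\<forall>x\<in>F. dist (\<nu> (d (x - s))) (h (x - t0)) < \<delta>)" for \<nu> s
      by (simp add: W_def h)
    have "openin vague_topology (W s)" for s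
      unfolding W_def using F(1) dc by (intro openin_vague_topology_basic) auto
    moreover have "hull_of \<mu> \<subseteq> (\<Union>s. W s)"
    proof
      fix \<nu> assume \<nu>: "\<nu> \<in> hull_of \<mu>"
      have orb: "orbit \<nu> \<subseteq> radon_measures"
        using orbit_subset_radon_measures[OF rad tb] hull_subset_dominated[OF rad tb] \<nu> by blast
      \<comment> \<open>Minimality enters here: the orbit of \<open>\<nu>\<close> comes close to the
        translate of \<open>\<mu>\<close> by \<open>t0\<close>, which puts \<open>\<nu>\<close> into
        some \<open>W s\<close>.\<close>
      have "translate_measure t0 \<mu> \<in> hull_of \<mu>"
        using orbit_subset_hull_self[OF rad tb] by (auto simp: orbit_def)
      then have "translate_measure t0 \<mu> \<in> vague_topology closure_of orbit \<nu>"
        using min \<nu> unfolding minimal_hull_iff[OF rad tb] by blast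
      moreover have "finite (d ` F)" "d ` F \<subseteq> C_c"
        using F(1) dc by auto
      ultimately obtain s where s: "\<forall>f\<in>d ` F. dist (\<nu> (\<lambda>x. f (s + x))) (translate_measure t0 \<mu> f) < \<delta>"
        using F(2) unfolding in_orbit_closure_iff[OF orb] by blast
      have "dist (\<nu> (d (x - s))) (h (x - t0)) < \<delta>" if "x \<in> F" for x
        using bspec[OF s imageI[OF that]] by (simp add: translate_measure_apply dc dt h)
      moreover have "\<nu> \<in> radon_measures"
        using \<nu> in_hull_iff[OF rad tb] by blast
      ultimately have "\<nu> \<in> W s"
        by (simp add: W)
      then show "\<nu> \<in> (\<Union>s. W s)" by blast
    qed
    ultimately obtain \<F> where \<F>: "finite \<F>" "\<F> \<subseteq> range W" "hull_of \<mu> \<subseteq> \<Union>\<F>"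
      using compactinD[OF compactin_hull[OF rad tb], of "range W"] by auto
    then obtain S where S: "finite S" "\<F> = W ` S"
      by (meson finite_subset_image)
    \<comment> \<open>Applied to the translates of \<open>\<mu>\<close>, the finite subcover says
      that finitely many translates of \<open>V\<close> cover the group.\<close>
    have "\<exists>s\<in>S. s + t \<in> V" for t
    proof -
      have "translate_measure t \<mu> \<in> hull_of \<mu>"
        using orbit_subset_hull_self[OF rad tb] by (auto simp: orbit_def)
      then obtain s where s: "s \<in> S" "translate_measure t \<mu> \<in> W s"
        using \<F>(3) S(2) by blast
      then have "\<forall>x\<in>F. dist (h (x - (s + t))) (h (x - t0)) < \<delta>"
        by (simp add: W translate_measure_apply dc dt h diff_diff_eq)
      then show ?thesis
        using F(3) s(1) by blast
    qed
    then have "\<exists>N. finite N \<and> (\<forall>t. \<exists>s\<in>N. s + t \<in> V)"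
      using S(1) by blast
    \<comment> \<open>A one-point index set reduces the simultaneous net to this: every
      \<open>t\<close> shares with some \<open>t'\<close> in \<open>N\<close> a shift
      \<open>s\<close> that moves both into \<open>V\<close>.\<close>
    then obtain N where N: "finite N" "\<And>t. \<exists>t'\<in>N. \<forall>i\<in>{()}. \<exists>s. s + t \<in> V \<and> s + t' \<in> V"
      by (rule common_finite_net[of "{()}" "\<lambda>_ t s. s + t \<in> V", rotated]) auto
    have "\<exists>s\<in>N. \<forall>x. dist (h (x - t)) (h (x - s)) \<le> e" for t
    proof -
      obtain t' s where t': "t' \<in> N" "s + t \<in> V" "s + t' \<in> V"
        using N(2)[of t] by auto
      have "dist (h (x - t)) (h (x - t')) \<le> e" for x
        using diam[OF t'(2,3), of "x + s"] by (simp add: algebra_simps)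
      then show ?thesis
        using t'(1) by blast
    qed
    then show ?thesis
      using N(1) by blast
  qed
  ultimately have "bohr_almost_periodic h"
    by (simp add: bohr_almost_periodic_iff_net)
  then show ?thesis
    by (simp add: h_def)
qed

text \<open>Every point of the hull is a limit of translates of \<open>\<mu>\<close>, so it is
  enough to recover \<open>\<mu>\<close> itself from the orbit of each \<open>\<nu>\<close> in the
  hull; this is \<open>return\<close>.\<close>

lemma strongly_almost_periodic_imp_minimal_hull:
  fixes \<mu> :: "('g::{topological_ab_group_add,t2_space} \<Rightarrow> complex) \<Rightarrow> complex"
  assumes sap: "strongly_almost_periodic \<mu>"
  shows "minimal_hull \<mu>"
proof -
  have rad: "\<mu> \<in> radon_measures" and tb: "translation_bounded \<mu>"
    and bohr: "\<And>c. c \<in> C_c \<Longrightarrow> bohr_almost_periodic (convolve c \<mu>)"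
    using sap by (auto simp: strongly_almost_periodic_def)
  \<comment> \<open>The convolution of \<open>\<mu>\<close> with the reflection of \<open>f\<close>;
    its value at \<open>- t\<close> is the translate of \<open>\<mu>\<close> by \<open>t\<close>
    evaluated at \<open>f\<close>.\<close>
  define H where "H = (\<lambda>f x. \<mu> (\<lambda>y. f (y - x)))"
  have net: "\<exists>N. finite N \<and> (\<forall>t. \<exists>s\<in>N. \<forall>x. dist (H f (x - t)) (H f (x - s)) \<le> e)"
    if f: "f \<in> C_c" and "e > 0" for f e
  proof -
    have "(\<lambda>x. f (- x)) \<in> C_c"
      using C_c_reflect[OF f, of 0] by simp
    then have "bohr_almost_periodic (convolve (\<lambda>x. f (- x)) \<mu>)"
      by (rule bohr)
    moreover have "convolve (\<lambda>x. f (- x)) \<mu> = H f"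
      by (simp add: convolve_def H_def fun_eq_iff)
    ultimately have "bohr_almost_periodic (H f)" by simp
    moreover from this have "H f \<in> C_u"
      by (simp add: bohr_almost_periodic_def)
    ultimately show ?thesis
      using bohr_almost_periodic_iff_net \<open>e > 0\<close> by blast
  qed
  have return: "\<exists>s. \<forall>f\<in>F. dist (\<nu> (\<lambda>x. f (s + x))) (\<mu> f) < e"
    if \<nu>: "\<nu> \<in> hull_of \<mu>" and F: "finite F" "F \<subseteq> C_c" and e: "e > 0" for \<nu> F e
  proof -
    \<comment> \<open>With \<open>e / 4\<close>, two translations sharing a net point are within
      \<open>e / 2\<close>, leaving \<open>e / 2\<close> for the vague approximation.\<close>
    have "\<exists>N. finite N \<and> (\<forall>t. \<exists>s\<in>N. \<forall>x. dist (H f (x - t)) (H f (x - s)) \<le> e / 4)" if "f \<in> F" for f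
      using that F e by (intro net) auto
    with \<open>finite F\<close> obtain N where N: "finite N"
      "\<And>t. \<exists>t'\<in>N. \<forall>f\<in>F. \<exists>s. (\<forall>x. dist (H f (x - t)) (H f (x - s)) \<le> e / 4) \<and>
          (\<forall>x. dist (H f (x - t')) (H f (x - s)) \<le> e / 4)"
      by (rule common_finite_net[where R = "\<lambda>f t s. \<forall>x. dist (H f (x - t)) (H f (x - s)) \<le> e / 4"]) blast+
    \<comment> \<open>Uniformity in \<open>x\<close>: if every candidate \<open>s\<close> in the
      finite set \<open>N\<close> failed, one bad function and point for each \<open>s\<close> would
      form a finite set of test functions. A vague approximation on this set already refutes the
      candidate representing it.\<close>
    have "\<exists>s\<in>N. \<forall>f\<in>F. \<forall>x. dist (H f (x - s)) (\<nu> (\<lambda>y. f (y - x))) < e"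
    proof (rule ccontr)
      assume "\<not> ?thesis"
      then have "\<forall>s\<in>N. \<exists>f x. f \<in> F \<and> dist (H f (x - s)) (\<nu> (\<lambda>y. f (y - x))) \<ge> e"
        by (meson not_less)
      then obtain g X where gX: "\<And>s. s \<in> N \<Longrightarrow> g s \<in> F"
          "\<And>s. s \<in> N \<Longrightarrow> dist (H (g s) (X s - s)) (\<nu> (\<lambda>y. g s (y - X s))) \<ge> e"
        by metis
      define G where "G = (\<lambda>s y. g s (y - X s)) ` N"
      have "(\<lambda>y. g s (y - X s)) \<in> C_c" if "s \<in> N" for s
        using C_c_translate(1)[of "g s" "- X s"] gX(1)[OF that] F(2) by (auto simp: add.commute)
      then have "G \<subseteq> C_c" "finite G"
        using N(1) by (auto simp: G_def)
      moreover have "e / 2 > 0"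
        using e by simp
      ultimately obtain t where t: "\<forall>f\<in>G. dist (\<mu> (\<lambda>x. f (t + x))) (\<nu> f) < e / 2"
        using \<nu> unfolding in_hull_iff[OF rad tb] by blast
      obtain s where s: "s \<in> N" "\<And>f. f \<in> F \<Longrightarrow> \<exists>r. (\<forall>x. dist (H f (x - t)) (H f (x - r)) \<le> e / 4) \<and>
          (\<forall>x. dist (H f (x - s)) (H f (x - r)) \<le> e / 4)"
        using N(2)[of t] by blast
      then obtain r where r: "\<And>x. dist (H (g s) (x - t)) (H (g s) (x - r)) \<le> e / 4"
          "\<And>x. dist (H (g s) (x - s)) (H (g s) (x - r)) \<le> e / 4"
        using gX(1) by blast
      have "dist (\<mu> (\<lambda>x. g s (t + x - X s))) (\<nu> (\<lambda>y. g s (y - X s))) < e / 2"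
        using t s(1) by (auto simp: G_def)
      moreover have "\<mu> (\<lambda>x. g s (t + x - X s)) = H (g s) (X s - t)"
        by (simp add: H_def algebra_simps)
      ultimately have "dist (H (g s) (X s - t)) (\<nu> (\<lambda>y. g s (y - X s))) < e / 2"
        by simp
      moreover have "dist (H (g s) (X s - s)) (H (g s) (X s - t)) \<le> e / 2"
        using dist_triangle[of "H (g s) (X s - s)" "H (g s) (X s - t)" "H (g s) (X s - r)"] r[of "X s"]
        by (simp add: dist_commute)
      ultimately have "dist (H (g s) (X s - s)) (\<nu> (\<lambda>y. g s (y - X s))) < e"
        using dist_triangle[of "H (g s) (X s - s)" "\<nu> (\<lambda>y. g s (y - X s))" "H (g s) (X s - t)"] by linarith
      then show False
        using gX(2)[OF s(1)] by simp
    qed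
    then obtain s where s: "\<And>f x. f \<in> F \<Longrightarrow> dist (H f (x - s)) (\<nu> (\<lambda>y. f (y - x))) < e" by blast
    \<comment> \<open>Taking \<open>x = s\<close> in the uniform estimate turns
      \<open>H f (x - s)\<close> into \<open>\<mu> f\<close> and moves the translation to
      \<open>\<nu>\<close>.\<close>
    have "dist (\<nu> (\<lambda>x. f (- s + x))) (\<mu> f) < e" if "f \<in> F" for f
      using s[OF that, of s] by (simp add: H_def dist_commute)
    then show ?thesis by blast
  qed
  have "hull_of \<mu> \<subseteq> vague_topology closure_of orbit \<nu>" if \<nu>: "\<nu> \<in> hull_of \<mu>" for \<nu>
  proof
    fix \<eta> assume \<eta>: "\<eta> \<in> hull_of \<mu>"
    have orb: "orbit \<nu> \<subseteq> radon_measures"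
      using orbit_subset_radon_measures[OF rad tb] hull_subset_dominated[OF rad tb] \<nu> by blast
    have "\<exists>t. \<forall>f\<in>F. dist (\<nu> (\<lambda>x. f (t + x))) (\<eta> f) < e" if F: "finite F" "F \<subseteq> C_c" and e: "e > 0" for F e
    proof -
      have "e / 2 > 0"
        using e by simp
      then obtain t where t: "\<forall>f\<in>F. dist (\<mu> (\<lambda>x. f (t + x))) (\<eta> f) < e / 2"
        using \<eta> F unfolding in_hull_iff[OF rad tb] by blast
      \<comment> \<open>First \<open>\<eta>\<close> is approximated by a translate of
        \<open>\<mu>\<close>, then \<open>\<mu>\<close> on the shifted test functions by a translate
        of \<open>\<nu>\<close>; the translations add up to \<open>t + s\<close>.\<close>
      define G where "G = (\<lambda>f x. f (t + x)) ` F"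
      have "finite G" "G \<subseteq> C_c"
        using F by (auto simp: G_def intro: C_c_translate(1))
      then obtain s where s: "\<forall>g\<in>G. dist (\<nu> (\<lambda>x. g (s + x))) (\<mu> g) < e / 2"
        using return[OF \<nu> _ _ \<open>e / 2 > 0\<close>] by blast
      have "dist (\<nu> (\<lambda>x. f (t + s + x))) (\<eta> f) < e" if f: "f \<in> F" for f
      proof -
        have "dist (\<nu> (\<lambda>x. f (t + s + x))) (\<mu> (\<lambda>x. f (t + x))) < e / 2"
          using s f by (auto simp: G_def add.assoc)
        then show ?thesis
          using bspec[OF t f] dist_triangle[of "\<nu> (\<lambda>x. f (t + s + x))" "\<eta> f" "\<mu> (\<lambda>x. f (t + x))"]
          by linarith
      qed
      then show ?thesis by blast
    qed
    moreover have "\<eta> \<in> radon_measures"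
      using \<eta> in_hull_iff[OF rad tb] by blast
    ultimately show "\<eta> \<in> vague_topology closure_of orbit \<nu>"
      unfolding in_orbit_closure_iff[OF orb] by blast
  qed
  then show ?thesis
    unfolding minimal_hull_iff[OF rad tb] by blast
qed

theorem corollary3p9:
  fixes \<mu> :: "('g::{topological_ab_group_add,t2_space} \<Rightarrow> complex) \<Rightarrow> complex"
  assumes "locally_compact_space (euclidean :: 'g topology)"
    and "weakly_almost_periodic \<mu>"
  shows "minimal_hull \<mu> \<longleftrightarrow> strongly_almost_periodic \<mu>"
proof
  assume "minimal_hull \<mu>"
  then show "strongly_almost_periodic \<mu>"
    using assms(2) minimal_hull_imp_bohr_almost_periodic
    by (auto simp: strongly_almost_periodic_def weakly_almost_periodic_def)
qed (rule strongly_almost_periodic_imp_minimal_hull)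

end
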